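(* Let $0<q<1$. There exists a quantized irreducible flag manifold, i.e. a pair $(\mathfrak g,\alpha_t)$ of cominuscule type, such that for every Dolbeault-Dirac operator $D\in U_q(\mathfrak g)\otimes \mathrm{Cl}_q$ corresponding to it, there do not exist finitely many central elements $C_i\in U_q(\mathfrak g)$ and elements $T_i\in\mathrm{Cl}_q$ with $$D^2\sim\sum_i C_i\otimes T_i .$$ Here $A\sim B$ means $A-B\in U_q(\mathfrak l)\otimes\mathrm{Cl}_q$, where $U_q(\mathfrak l)$ is the quantized Levi factor.
   Context: Setting. $\mathfrak g$ is a finite-dimensional complex simple Lie algebra with Cartan subalgebra $\mathfrak h$, simple roots $\Pi=\{\alpha_1,\dots,\alpha_r\}$, Cartan matrix $(a_{ij})$, usual invariant form $(\cdot,\cdot)$ on $\mathfrak h^*$ (short roots have $(\alpha,\alpha)=2$), $d_i=(\alpha_i,\alpha_i)/2$, $q_i=q^{d_i}$. $U_q(\mathfrak g)$ is generated by $E_i,F_i,K_i^{\pm1}$ with $K_iK_j=K_jK_i$, $K_iE_jK_i^{-1}=q_i^{a_{ij}}E_j$, $K_iF_jK_i^{-1}=q_i^{-a_{ij}}F_j$, $E_iF_j-F_jE_i=\delta_{ij}\frac{K_i-K_i^{-1}}{q_i-q_i^{-1}}$ and the quantum Serre relations. Hopf structure: $\Delta(K_i)=K_i\otimes K_i$, $\Delta(E_i)=E_i\otimes 1+K_i\otimes E_i$, $\Delta(F_i)=F_i\otimes K_i^{-1}+1\otimes F_i$, $S(K_i)=K_i^{-1}$, $S(E_i)=-K_i^{-1}E_i$,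 $S(F_i)=-F_iK_i$, $\varepsilon(K_i)=1$, $\varepsilon(E_i)=\varepsilon(F_i)=0$. The $*$-structure (compact real form) is $K_i^*=K_i$, $E_i^*=K_iF_i$, $F_i^*=E_iK_i^{-1}$. The (left) adjoint action is $X\triangleright Y=X_{(1)}YS(X_{(2)})$. Cominuscule pairs. $(\mathfrak g,\alpha_t)$ is of cominuscule type if the simple root $\alpha_t$ occurs with multiplicity $1$ in the highest root of $\mathfrak g$; these correspond to irreducible flag manifolds. Put $S=\Pi\setminus\{\alpha_t\}$, $\Delta(\mathfrak l)=\mathrm{span}(S)\cap\Delta(\mathfrak g)$ (the roots of the Levi factor $\mathfrak l$), $\Delta(\mathfrak u_+)=\Delta^+(\mathfrak g)\setminus\Delta^+(\mathfrak l)$ (the radical roots $\xi_i$). $U_q(\mathfrak l)\subset U_q(\mathfrak g)$ is the subalgebra generated by all $K_i^{\pm1}$ and by $E_j,F_j$ with $\alpha_j\in S$. Quantum root vectors. Let $T_i$ be Lusztig's automorphisms: $T_i(K_j)=K_jK_i^{-a_{ij}}$, $T_i(E_i)=-F_iK_i$, $T_i(F_i)=-K_i^{-1}E_i$, and for $j\ne i$, $T_i(E_j)=\sum_{s=0}^{-a_{ij}}(-1)^sq_i^{-s}E_i^{(-a_{ij}-s)}E_jE_i^{(s)}$, $T_i(F_j)=\sum_{s=0}^{-a_{ij}}(-1)^sq_i^{s}F_i^{(s)}F_jF_i^{(-a_{ij}-s)}$ (divided powers). Fix a reduced decomposition $w_0=s_{i_1}\cdots s_{i_N}$ of the longest Weyl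 group element whose initial segment is a reduced decomposition of the longest element of the Weyl group of $\mathfrak l$. For $\beta_k=s_{i_1}\cdots s_{i_{k-1}}(\alpha_{i_k})$ put $E_{\beta_k}=T_{i_1}\cdots T_{i_{k-1}}(E_{i_k})$. The span of $\{E_\xi\}_{\xi\in\Delta(\mathfrak u_+)}$ with the adjoint action is a simple $U_q(\mathfrak l)$-module, denoted $\mathfrak u_+$; its basis $v_i:=E_{\xi_i}$ has weights $\xi_i$. Let $\mathfrak u_-$ be the dual vector space with dual basis $\{w_i\}$, $\langle w_i,v_j\rangle=\delta_{ij}$, and with the $U_q(\mathfrak l)$-action for which $\langle X_{(1)}w,X_{(2)}v\rangle=\varepsilon(X)\langle w,v\rangle$. Quantum exterior algebras. For finite-dimensional weight modules $V,W$ of $U_q(\mathfrak l)$, the braiding $\hat R_{V,W}:V\otimes W\to W\otimes V$ is the module map determined by $\hat R_{V,W}(v\otimes w)=q^{(\mathrm{wt}(v),\mathrm{wt}(w))}w\otimes v+\sum_iw_i\otimes v_i$ with $\mathrm{wt}(w_i)>\mathrm{wt}(w)$, $\mathrm{wt}(v_i)<\mathrm{wt}(v)$. For $V=\mathfrak u_\pm$, let $S_q^2V$ (resp. $\Lambda_q^2V$) be the span of eigenvectors of $\hat R_{V,V}$ with positive (resp. negative) eigenvalues. $\Lambda_q(V)=T(V)/\langle S_q^2V\rangle$, a graded algebra with product $\wedge$ and components $\Lambda_q^k(V)$. Let $\Lambda_q^kV\subset V^{\otimes k}$ be the space of tensors lying in $V^{\otimes i}\otimes\Lambda_q^2V\otimes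 V^{\otimes(k-2-i)}$ for all $0\le i\le k-2$; the composite $\pi:\Lambda_q^kV\hookrightarrow V^{\otimes k}\twoheadrightarrow\Lambda_q^k(V)$ is an equivariant isomorphism (write $\pi_\pm$ for $V=\mathfrak u_\pm$). Pair $\mathfrak u_-^{\otimes k}$ with $\mathfrak u_+^{\otimes k}$ by $\langle x_k\otimes\cdots\otimes x_1,y_1\otimes\cdots\otimes y_k\rangle_T=\prod_i\langle x_i,y_i\rangle$, and $\Lambda_q^k(\mathfrak u_-)$ with $\Lambda_q^k(\mathfrak u_+)$ by $\langle w,v\rangle_k=\lambda_k\langle\pi_-^{-1}(w),\pi_+^{-1}(v)\rangle_T$, where the nonzero scalars $\lambda_k$ may be chosen freely in each degree. Quantum Clifford algebra and Dolbeault-Dirac operator. $\mathrm{Cl}_q=\mathrm{End}_{\mathbb C}(\Lambda_q(\mathfrak u_+))$. For $z\in\mathfrak u_-$, the degree $-1$ operator $\gamma_-(z)\in\mathrm{Cl}_q$ is defined by $\langle w,\gamma_-(z)v\rangle_k=\langle w\wedge z,v\rangle_{k+1}$ for $w\in\Lambda_q^k(\mathfrak u_-)$, $v\in\Lambda_q^{k+1}(\mathfrak u_+)$ (and $\gamma_-(z)1=0$). Fix a Hermitian inner product (conjugate-linear in the first variable, different degrees orthogonal) on $\Lambda_q(\mathfrak u_+)$ with $(v,Xv')=(X^*v,v')$ for $X\in U_q(\mathfrak l)$; it makes $\mathrm{Cl}_q$ a $*$-algebra. Set $$\eth=\sum_iS^{-1}(E_{\xi_i})\otimes\gamma_-(w_i)\in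 U_q(\mathfrak g)\otimes\mathrm{Cl}_q,\qquad D=\eth+\eth^*,$$ with $*$ acting on both tensor factors. Any $D$ obtained in this way (for any choice of scalars $\lambda_k$ and invariant inner product) is a Dolbeault-Dirac operator corresponding to the quantized irreducible flag manifold of $(\mathfrak g,\alpha_t)$. *)

theory Defs
  imports Complex_Main "HOL-Library.Poly_Mapping" "HOL-Library.Product_Plus"
begin

section \<open>Complex vector spaces with a basis, free algebras\<close>

text \<open>
  A complex vector space with basis \<open>'k\<close> is the type \<open>'k \<Rightarrow>\<^sub>0 complex\<close>.
\<close>

abbreviation "lookup \<equiv> Poly_Mapping.lookup"
abbreviation "keys \<equiv> Poly_Mapping.keys"

definition cscale :: "complex \<Rightarrow> ('k \<Rightarrow>\<^sub>0 complex) \<Rightarrow> ('k \<Rightarrow>\<^sub>0 complex)" (infixr \<open>*\<^sub>C\<close> 75)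
  where "c *\<^sub>C x = Poly_Mapping.map ((*) c) x"

lemma lookup_cscale [simp]: "lookup (c *\<^sub>C x) k = c * lookup x k"
  by (simp add: cscale_def Poly_Mapping.map.rep_eq when_def)

interpretation cvec: vector_space cscale
  by unfold_locales
    (auto intro!: poly_mapping_eqI simp: lookup_add distrib_left distrib_right)

text \<open>
  Words form the free monoid, written additively so that the convolution product of
  polynomial mappings makes \<open>'a free_alg\<close> the free unital associative algebra on \<open>'a\<close>
  (equivalently, the tensor algebra of the vector space with basis \<open>'a\<close>).
  Likewise \<open>'a fword \<times> 'a fword \<Rightarrow>\<^sub>0 complex\<close> is the tensor square of that algebra.
\<close>

datatype 'a fword = Word (letters: "'a list")

instantiation fword :: (type) monoid_add
begin
definition "0 = Word []"
definition "u + v = Word (letters u @ letters v)"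
instance by standard (simp_all add: zero_fword_def plus_fword_def)
end

type_synonym 'a free_alg = "'a fword \<Rightarrow>\<^sub>0 complex"

definition letter :: "'a \<Rightarrow> 'a free_alg"
  where "letter a = Poly_Mapping.single (Word [a]) 1"

definition basis_word :: "'a fword \<Rightarrow> 'a free_alg"
  where "basis_word w = Poly_Mapping.single w 1"

definition lin_ext :: "('a list \<Rightarrow> ('k \<Rightarrow>\<^sub>0 complex)) \<Rightarrow> 'a free_alg \<Rightarrow> ('k \<Rightarrow>\<^sub>0 complex)"
  where "lin_ext f x = (\<Sum>w\<in>keys x. lookup x w *\<^sub>C f (letters w))"

definition alg_hom ::
    "('a \<Rightarrow> ('k::monoid_add \<Rightarrow>\<^sub>0 complex)) \<Rightarrow> 'a free_alg \<Rightarrow> ('k \<Rightarrow>\<^sub>0 complex)"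
  where "alg_hom f = lin_ext (\<lambda>l. prod_list (map f l))"

definition alg_antihom :: "('a \<Rightarrow> 'b free_alg) \<Rightarrow> 'a free_alg \<Rightarrow> 'b free_alg"
  where "alg_antihom f = lin_ext (\<lambda>l. prod_list (map f (rev l)))"

definition conj_antihom :: "('a \<Rightarrow> 'b free_alg) \<Rightarrow> 'a free_alg \<Rightarrow> 'b free_alg"
  where "conj_antihom f x =
    (\<Sum>w\<in>keys x. cnj (lookup x w) *\<^sub>C prod_list (map f (rev (letters w))))"

definition ideal_generated :: "'a free_alg set \<Rightarrow> 'a free_alg set"
  where "ideal_generated G = cvec.span {a * x * b | a x b. x \<in> G}"

typedef 'k endo = "{f :: ('k \<Rightarrow>\<^sub>0 complex) \<Rightarrow> ('k \<Rightarrow>\<^sub>0 complex). Vector_Spaces.linear cscale cscale f}"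
  morphisms app_endo Abs_endo
  by (rule exI[of _ id]) (simp add: cvec.linear_id)

setup_lifting type_definition_endo

lemma linear_cscale_iff:
  "Vector_Spaces.linear cscale cscale f \<longleftrightarrow>
    (\<forall>x y. f (x + y) = f x + f y) \<and> (\<forall>c x. f (c *\<^sub>C x) = c *\<^sub>C f x)"
  by (auto simp: Vector_Spaces.linear_iff cvec.vector_space_axioms)

instantiation endo :: (type) ring_1
begin
lift_definition zero_endo :: "'a endo" is "\<lambda>x. 0"
  by (simp add: linear_cscale_iff cvec.scale_zero_right)
lift_definition one_endo :: "'a endo" is "\<lambda>x. x"
  by (simp add: linear_cscale_iff)
lift_definition plus_endo :: "'a endo \<Rightarrow> 'a endo \<Rightarrow> 'a endo" is "\<lambda>f g x. f x + g x"
  by (simp add: linear_cscale_iff algebra_simps cvec.scale_right_distrib)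
lift_definition minus_endo :: "'a endo \<Rightarrow> 'a endo \<Rightarrow> 'a endo" is "\<lambda>f g x. f x - g x"
  by (simp add: linear_cscale_iff algebra_simps cvec.scale_right_diff_distrib)
lift_definition uminus_endo :: "'a endo \<Rightarrow> 'a endo" is "\<lambda>f x. - f x"
  by (simp add: linear_cscale_iff)
lift_definition times_endo :: "'a endo \<Rightarrow> 'a endo \<Rightarrow> 'a endo" is "\<lambda>f g x. f (g x)"
  by (simp add: linear_cscale_iff)
instance
proof
  show "(0::'a endo) \<noteq> 1"
  proof (transfer, rule notI)
    assume *: "(\<lambda>x::'a \<Rightarrow>\<^sub>0 complex. 0) = (\<lambda>x. x)"
    have "(0::'a \<Rightarrow>\<^sub>0 complex) = Poly_Mapping.single undefined 1"
      using fun_cong[OF *] by simp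
    then have "lookup (0::'a \<Rightarrow>\<^sub>0 complex) undefined = 1"
      by (metis lookup_single_eq)
    then show False by simp
  qed
qed (transfer; simp add: linear_cscale_iff fun_eq_iff algebra_simps)+
end

lift_definition scale_endo :: "complex \<Rightarrow> 'k endo \<Rightarrow> 'k endo" is "\<lambda>c f x. c *\<^sub>C f x"
  by (simp add: linear_cscale_iff cvec.scale_right_distrib mult.commute)

text \<open>
  The tensor product of a free algebra with an algebra of endomorphisms consists of the
  polynomial mappings \<open>'a fword \<Rightarrow>\<^sub>0 'k endo\<close>; their convolution product is
  \<open>(a \<otimes> s)(b \<otimes> t) = ab \<otimes> st\<close>.
\<close>

definition pure_tensor :: "'a free_alg \<Rightarrow> 'k endo \<Rightarrow> ('a fword \<Rightarrow>\<^sub>0 'k endo)" (infix \<open>\<otimes>\<^sub>C\<close> 72)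
  where "a \<otimes>\<^sub>C s = Poly_Mapping.map (\<lambda>c. scale_endo c s) a"


section \<open>Simple Lie algebras and cominuscule pairs\<close>

text \<open>
  Finite-dimensional Lie algebras are realised on subspaces \<open>g\<close> of a space of countable
  dimension (up to isomorphism this is no restriction).  The bracket only matters on \<open>g\<close>,
  and linear functionals on \<open>h\<close> only matter on \<open>h\<close>.
\<close>

type_synonym vec = "nat \<Rightarrow>\<^sub>0 complex"

definition lie_algebra :: "vec set \<Rightarrow> (vec \<Rightarrow> vec \<Rightarrow> vec) \<Rightarrow> bool" where
  "lie_algebra g br \<longleftrightarrow>
     (\<exists>B. finite B \<and> g = cvec.span B) \<and>
     (\<forall>x\<in>g. \<forall>y\<in>g. br x y \<in> g) \<and>
     (\<forall>x\<in>g. \<forall>y\<in>g. \<forall>z\<in>g. br (x + y) z = br x z + br y z \<and> br z (x + y) = br z x + br z y) \<and>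
     (\<forall>c. \<forall>x\<in>g. \<forall>y\<in>g. br (c *\<^sub>C x) y = c *\<^sub>C br x y \<and> br x (c *\<^sub>C y) = c *\<^sub>C br x y) \<and>
     (\<forall>x\<in>g. br x x = 0) \<and>
     (\<forall>x\<in>g. \<forall>y\<in>g. \<forall>z\<in>g. br x (br y z) + br y (br z x) + br z (br x y) = 0)"

definition simple_lie_algebra :: "vec set \<Rightarrow> (vec \<Rightarrow> vec \<Rightarrow> vec) \<Rightarrow> bool" where
  "simple_lie_algebra g br \<longleftrightarrow>
     lie_algebra g br \<and>
     (\<exists>x\<in>g. \<exists>y\<in>g. br x y \<noteq> 0) \<and>
     (\<forall>I. cvec.subspace I \<and> I \<subseteq> g \<and> (\<forall>x\<in>g. \<forall>y\<in>I. br x y \<in> I) \<longrightarrow> I = {0} \<or> I = g)"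

fun lower_central_series :: "(vec \<Rightarrow> vec \<Rightarrow> vec) \<Rightarrow> vec set \<Rightarrow> nat \<Rightarrow> vec set" where
  "lower_central_series br h 0 = h"
| "lower_central_series br h (Suc n) =
     cvec.span {br x y | x y. x \<in> h \<and> y \<in> lower_central_series br h n}"

definition cartan_subalgebra :: "vec set \<Rightarrow> (vec \<Rightarrow> vec \<Rightarrow> vec) \<Rightarrow> vec set \<Rightarrow> bool" where
  "cartan_subalgebra g br h \<longleftrightarrow>
     cvec.subspace h \<and> h \<subseteq> g \<and> (\<forall>x\<in>h. \<forall>y\<in>h. br x y \<in> h) \<and>
     (\<exists>n. lower_central_series br h n = {0}) \<and>
     {x\<in>g. \<forall>y\<in>h. br x y \<in> h} = h"

definition is_root :: "vec set \<Rightarrow> (vec \<Rightarrow> vec \<Rightarrow> vec) \<Rightarrow> vec set \<Rightarrow> (vec \<Rightarrow> complex) \<Rightarrow> bool" where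
  "is_root g br h \<mu> \<longleftrightarrow>
     (\<exists>y\<in>h. \<mu> y \<noteq> 0) \<and> (\<exists>x\<in>g. x \<noteq> 0 \<and> (\<forall>y\<in>h. br y x = \<mu> y *\<^sub>C x))"

text \<open>
  The root lattice is \<open>nat \<Rightarrow>\<^sub>0 int\<close> (coefficients with respect to the simple roots, which
  are numbered \<open>0, \<dots>, r - 1\<close>).
\<close>

type_synonym lattice = "nat \<Rightarrow>\<^sub>0 int"

definition simple_root :: "nat \<Rightarrow> lattice"
  where "simple_root i = Poly_Mapping.single i 1"

definition nonneg :: "lattice \<Rightarrow> bool"
  where "nonneg \<beta> \<longleftrightarrow> (\<forall>i. 0 \<le> lookup \<beta> i)"

definition functional :: "nat \<Rightarrow> (nat \<Rightarrow> vec \<Rightarrow> complex) \<Rightarrow> lattice \<Rightarrow> vec \<Rightarrow> complex"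
  where "functional r \<alpha> \<beta> y = (\<Sum>i<r. of_int (lookup \<beta> i) * \<alpha> i y)"

definition simple_roots ::
    "vec set \<Rightarrow> (vec \<Rightarrow> vec \<Rightarrow> vec) \<Rightarrow> vec set \<Rightarrow> nat \<Rightarrow> (nat \<Rightarrow> vec \<Rightarrow> complex) \<Rightarrow> bool" where
  "simple_roots g br h r \<alpha> \<longleftrightarrow>
     (\<forall>i<r. is_root g br h (\<alpha> i)) \<and>
     (\<forall>c. (\<forall>y\<in>h. (\<Sum>i<r. c i * \<alpha> i y) = 0) \<longrightarrow> (\<forall>i<r. c i = 0)) \<and>
     (\<forall>\<mu>. is_root g br h \<mu> \<longrightarrow>
        (\<exists>\<beta>. keys \<beta> \<subseteq> {..<r} \<and> (nonneg \<beta> \<or> nonneg (- \<beta>)) \<and>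
             (\<forall>y\<in>h. \<mu> y = functional r \<alpha> \<beta> y)))"

definition roots ::
    "vec set \<Rightarrow> (vec \<Rightarrow> vec \<Rightarrow> vec) \<Rightarrow> vec set \<Rightarrow> nat \<Rightarrow> (nat \<Rightarrow> vec \<Rightarrow> complex) \<Rightarrow> lattice set" where
  "roots g br h r \<alpha> = {\<beta>. keys \<beta> \<subseteq> {..<r} \<and> is_root g br h (functional r \<alpha> \<beta>)}"

definition lattice_form :: "nat \<Rightarrow> (nat \<Rightarrow> nat \<Rightarrow> int) \<Rightarrow> lattice \<Rightarrow> lattice \<Rightarrow> int" where
  "lattice_form r gram \<beta> \<gamma> = (\<Sum>i<r. \<Sum>j<r. lookup \<beta> i * lookup \<gamma> j * gram i j)"

definition invariant_form ::
    "vec set \<Rightarrow> (vec \<Rightarrow> vec \<Rightarrow> vec) \<Rightarrow> (vec \<Rightarrow> vec \<Rightarrow> complex) \<Rightarrow> bool" where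
  "invariant_form g br B \<longleftrightarrow>
     (\<forall>x\<in>g. \<forall>y\<in>g. B x y = B y x) \<and>
     (\<forall>x\<in>g. \<forall>y\<in>g. \<forall>z\<in>g. B (x + y) z = B x z + B y z) \<and>
     (\<forall>c. \<forall>x\<in>g. \<forall>y\<in>g. B (c *\<^sub>C x) y = c * B x y) \<and>
     (\<forall>x\<in>g. \<forall>y\<in>g. \<forall>z\<in>g. B (br x y) z = B x (br y z)) \<and>
     (\<forall>x\<in>g. (\<forall>y\<in>g. B x y = 0) \<longrightarrow> x = 0)"

text \<open>
  \<open>gram i j = (\<alpha>\<^sub>i, \<alpha>\<^sub>j)\<close> for the form on the dual of \<open>h\<close> induced by an invariant form on
  \<open>g\<close> (\<open>\<tau> i\<close> is the element of \<open>h\<close> representing \<open>\<alpha> i\<close>), rescaled so that short roots have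
  \<open>(\<alpha>, \<alpha>) = 2\<close>.
\<close>

definition usual_form ::
    "vec set \<Rightarrow> (vec \<Rightarrow> vec \<Rightarrow> vec) \<Rightarrow> vec set \<Rightarrow> nat \<Rightarrow> (nat \<Rightarrow> vec \<Rightarrow> complex) \<Rightarrow>
     (nat \<Rightarrow> nat \<Rightarrow> int) \<Rightarrow> bool" where
  "usual_form g br h r \<alpha> gram \<longleftrightarrow>
     (\<exists>B \<tau>. invariant_form g br B \<and>
        (\<forall>i<r. \<tau> i \<in> h \<and> (\<forall>y\<in>h. B (\<tau> i) y = \<alpha> i y)) \<and>
        (\<forall>i<r. \<forall>j<r. of_int (gram i j) = B (\<tau> i) (\<tau> j))) \<and>
     (\<forall>\<beta>\<in>roots g br h r \<alpha>. 2 \<le> lattice_form r gram \<beta> \<beta>) \<and>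
     (\<exists>\<beta>\<in>roots g br h r \<alpha>. lattice_form r gram \<beta> \<beta> = 2)"

definition cominuscule_pair ::
    "vec set \<Rightarrow> (vec \<Rightarrow> vec \<Rightarrow> vec) \<Rightarrow> vec set \<Rightarrow> nat \<Rightarrow> (nat \<Rightarrow> vec \<Rightarrow> complex) \<Rightarrow>
     (nat \<Rightarrow> nat \<Rightarrow> int) \<Rightarrow> nat \<Rightarrow> bool" where
  "cominuscule_pair g br h r \<alpha> gram t \<longleftrightarrow>
     simple_lie_algebra g br \<and> cartan_subalgebra g br h \<and>
     simple_roots g br h r \<alpha> \<and> usual_form g br h r \<alpha> gram \<and>
     t < r \<and>
     (\<exists>\<theta>\<in>roots g br h r \<alpha>. (\<forall>\<beta>\<in>roots g br h r \<alpha>. nonneg (\<theta> - \<beta>)) \<and> lookup \<theta> t = 1)"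


section \<open>Weyl group\<close>

text \<open>The Cartan matrix \<open>a\<^sub>i\<^sub>j = 2(\<alpha>\<^sub>i, \<alpha>\<^sub>j)/(\<alpha>\<^sub>i, \<alpha>\<^sub>i)\<close>; both divisions are exact.\<close>

definition cartan :: "(nat \<Rightarrow> nat \<Rightarrow> int) \<Rightarrow> nat \<Rightarrow> nat \<Rightarrow> int"
  where "cartan gram i j = 2 * gram i j div gram i i"

definition half_norm :: "(nat \<Rightarrow> nat \<Rightarrow> int) \<Rightarrow> nat \<Rightarrow> int"
  where "half_norm gram i = gram i i div 2"

definition reflection :: "nat \<Rightarrow> (nat \<Rightarrow> nat \<Rightarrow> int) \<Rightarrow> nat \<Rightarrow> lattice \<Rightarrow> lattice" where
  "reflection r gram i \<beta> =
     \<beta> - Poly_Mapping.single i (\<Sum>j<r. lookup \<beta> j * cartan gram i j)"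

text \<open>\<open>weyl [i\<^sub>1, \<dots>, i\<^sub>k] = s\<^sub>i\<^sub>1 \<circ> \<dots> \<circ> s\<^sub>i\<^sub>k\<close>, acting on the root lattice (coefficients below \<open>r\<close>).\<close>

definition weyl :: "nat \<Rightarrow> (nat \<Rightarrow> nat \<Rightarrow> int) \<Rightarrow> nat list \<Rightarrow> lattice \<Rightarrow> lattice"
  where "weyl r gram ws = foldr (reflection r gram) ws"

definition same_weyl_element :: "nat \<Rightarrow> (nat \<Rightarrow> nat \<Rightarrow> int) \<Rightarrow> nat list \<Rightarrow> nat list \<Rightarrow> bool" where
  "same_weyl_element r gram us ws \<longleftrightarrow>
     (\<forall>\<beta>. keys \<beta> \<subseteq> {..<r} \<longrightarrow> weyl r gram us \<beta> = weyl r gram ws \<beta>)"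

definition reduced_word :: "nat \<Rightarrow> (nat \<Rightarrow> nat \<Rightarrow> int) \<Rightarrow> nat set \<Rightarrow> nat list \<Rightarrow> bool" where
  "reduced_word r gram I ws \<longleftrightarrow> set ws \<subseteq> I \<and>
     (\<forall>us. set us \<subseteq> I \<and> same_weyl_element r gram us ws \<longrightarrow> length ws \<le> length us)"

text \<open>A reduced decomposition of the longest element of the subgroup generated by the \<open>s\<^sub>i\<close>, \<open>i \<in> I\<close>.\<close>

definition longest_word :: "nat \<Rightarrow> (nat \<Rightarrow> nat \<Rightarrow> int) \<Rightarrow> nat set \<Rightarrow> nat list \<Rightarrow> bool" where
  "longest_word r gram I ws \<longleftrightarrow> reduced_word r gram I ws \<and>
     (\<forall>us. reduced_word r gram I us \<longrightarrow> length us \<le> length ws)"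


section \<open>The quantized enveloping algebra\<close>

text \<open>\<open>GKi i\<close> stands for the inverse of \<open>K\<^sub>i\<close>.\<close>

datatype gen = GE nat | GF nat | GK nat | GKi nat

type_synonym galg = "gen free_alg"

abbreviation "eE i \<equiv> (letter (GE i) :: galg)"
abbreviation "eF i \<equiv> (letter (GF i) :: galg)"
abbreviation "eK i \<equiv> (letter (GK i) :: galg)"
abbreviation "eKi i \<equiv> (letter (GKi i) :: galg)"

definition K_power :: "nat \<Rightarrow> int \<Rightarrow> galg"
  where "K_power i n = (if 0 \<le> n then eK i ^ nat n else eKi i ^ nat (- n))"

fun coproduct_gen :: "gen \<Rightarrow> (gen fword \<times> gen fword \<Rightarrow>\<^sub>0 complex)" where
  "coproduct_gen (GK i) = Poly_Mapping.single (Word [GK i], Word [GK i]) 1"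
| "coproduct_gen (GKi i) = Poly_Mapping.single (Word [GKi i], Word [GKi i]) 1"
| "coproduct_gen (GE i) = Poly_Mapping.single (Word [GE i], Word []) 1
                        + Poly_Mapping.single (Word [GK i], Word [GE i]) 1"
| "coproduct_gen (GF i) = Poly_Mapping.single (Word [GF i], Word [GKi i]) 1
                        + Poly_Mapping.single (Word [], Word [GF i]) 1"

definition coproduct :: "galg \<Rightarrow> (gen fword \<times> gen fword \<Rightarrow>\<^sub>0 complex)"
  where "coproduct = alg_hom coproduct_gen"

text \<open>\<open>sweedler f X\<close> is \<open>f(X\<^sub>(\<^sub>1\<^sub>), X\<^sub>(\<^sub>2\<^sub>))\<close> for a bilinear \<open>f\<close>.\<close>

definition sweedler :: "(galg \<Rightarrow> galg \<Rightarrow> ('k \<Rightarrow>\<^sub>0 complex)) \<Rightarrow> galg \<Rightarrow> ('k \<Rightarrow>\<^sub>0 complex)" where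
  "sweedler f X =
     (\<Sum>p\<in>keys (coproduct X). lookup (coproduct X) p *\<^sub>C f (basis_word (fst p)) (basis_word (snd p)))"

fun counit_gen :: "gen \<Rightarrow> complex" where
  "counit_gen (GK i) = 1"
| "counit_gen (GKi i) = 1"
| "counit_gen (GE i) = 0"
| "counit_gen (GF i) = 0"

definition counit :: "galg \<Rightarrow> complex" where
  "counit X = (\<Sum>w\<in>keys X. lookup X w * prod_list (map counit_gen (letters w)))"

fun antipode_gen :: "gen \<Rightarrow> galg" where
  "antipode_gen (GK i) = eKi i"
| "antipode_gen (GKi i) = eK i"
| "antipode_gen (GE i) = - (eKi i * eE i)"
| "antipode_gen (GF i) = - (eF i * eK i)"

definition antipode :: "galg \<Rightarrow> galg"
  where "antipode = alg_antihom antipode_gen"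

text \<open>The inverse of the antipode: \<open>S(- E\<^sub>i K\<^sub>i\<^sup>-\<^sup>1) = E\<^sub>i\<close> and \<open>S(- K\<^sub>i F\<^sub>i) = F\<^sub>i\<close>.\<close>

fun antipode_inv_gen :: "gen \<Rightarrow> galg" where
  "antipode_inv_gen (GK i) = eKi i"
| "antipode_inv_gen (GKi i) = eK i"
| "antipode_inv_gen (GE i) = - (eE i * eKi i)"
| "antipode_inv_gen (GF i) = - (eK i * eF i)"

definition antipode_inv :: "galg \<Rightarrow> galg"
  where "antipode_inv = alg_antihom antipode_inv_gen"

fun star_gen :: "gen \<Rightarrow> galg" where
  "star_gen (GK i) = eK i"
| "star_gen (GKi i) = eKi i"
| "star_gen (GE i) = eK i * eF i"
| "star_gen (GF i) = eE i * eKi i"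

definition star :: "galg \<Rightarrow> galg"
  where "star = conj_antihom star_gen"

definition adjoint_act :: "galg \<Rightarrow> galg \<Rightarrow> galg"
  where "adjoint_act X Y = sweedler (\<lambda>X1 X2. X1 * Y * antipode X2) X"


section \<open>Modules over the quantized Levi factor, tensor powers, quantum exterior algebras\<close>

text \<open>
  A vector space with basis indexed by a finite set \<open>N\<close> of naturals is the span of the letters
  in \<open>N\<close>, and its tensor powers consist of combinations of words in these letters.
\<close>

type_synonym talg = "nat free_alg"

definition tensor_power :: "nat set \<Rightarrow> nat \<Rightarrow> talg set" where
  "tensor_power N k = {x. \<forall>w\<in>keys x. length (letters w) = k \<and> set (letters w) \<subseteq> N}"

definition tensor_algebra :: "nat set \<Rightarrow> talg set" where
  "tensor_algebra N = {x. \<forall>w\<in>keys x. set (letters w) \<subseteq> N}"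

text \<open>
  An action is given by the images \<open>\<rho> X j\<close> of the basis vectors; it extends to tensor products
  by \<open>X(v \<otimes> w) = X\<^sub>(\<^sub>1\<^sub>)v \<otimes> X\<^sub>(\<^sub>2\<^sub>)w\<close>.
\<close>

type_synonym action = "galg \<Rightarrow> nat \<Rightarrow> talg"

fun act_word :: "action \<Rightarrow> galg \<Rightarrow> nat list \<Rightarrow> talg" where
  "act_word \<rho> X [] = Poly_Mapping.single 0 (counit X)"
| "act_word \<rho> X (j # js) = sweedler (\<lambda>X1 X2. \<rho> X1 j * act_word \<rho> X2 js) X"

definition act :: "action \<Rightarrow> galg \<Rightarrow> talg \<Rightarrow> talg"
  where "act \<rho> X = lin_ext (act_word \<rho> X)"

text \<open>\<open>\<langle>x\<^sub>k \<otimes> \<dots> \<otimes> x\<^sub>1, y\<^sub>1 \<otimes> \<dots> \<otimes> y\<^sub>k\<rangle>\<^sub>T = \<Prod>\<^sub>i \<langle>x\<^sub>i, y\<^sub>i\<rangle>\<close>, with respect to dual bases indexed alike.\<close>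

definition pairing_T :: "talg \<Rightarrow> talg \<Rightarrow> complex" where
  "pairing_T x y = (\<Sum>w\<in>keys y. lookup x (Word (rev (letters w))) * lookup y w)"

text \<open>A braiding is given by its values \<open>R i j\<close> on the basis of \<open>V \<otimes> V\<close>.\<close>

type_synonym braiding = "nat \<Rightarrow> nat \<Rightarrow> talg"

definition braid :: "braiding \<Rightarrow> talg \<Rightarrow> talg"
  where "braid R = lin_ext (\<lambda>l. R (l ! 0) (l ! 1))"

definition S2 :: "nat set \<Rightarrow> braiding \<Rightarrow> talg set" where
  "S2 N R = cvec.span {x \<in> tensor_power N 2. \<exists>c::real. 0 < c \<and> braid R x = of_real c *\<^sub>C x}"

definition \<Lambda>2 :: "nat set \<Rightarrow> braiding \<Rightarrow> talg set" where
  "\<Lambda>2 N R = cvec.span {x \<in> tensor_power N 2. \<exists>c::real. c < 0 \<and> braid R x = of_real c *\<^sub>C x}"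

text \<open>
  The quantum exterior algebra is \<open>talg\<close> modulo the following ideal; the letters outside \<open>N\<close>
  are added to the relations in order to pass from \<open>talg\<close> to \<open>T(V)\<close>.
\<close>

definition exterior_ideal :: "nat set \<Rightarrow> braiding \<Rightarrow> talg set" where
  "exterior_ideal N R = ideal_generated (S2 N R \<union> {letter j | j. j \<notin> N})"

definition \<Lambda>_sub :: "nat set \<Rightarrow> braiding \<Rightarrow> nat \<Rightarrow> talg set" where
  "\<Lambda>_sub N R k = {x \<in> tensor_power N k. \<forall>i. i + 2 \<le> k \<longrightarrow>
     x \<in> cvec.span {u * y * v | u y v.
       u \<in> tensor_power N i \<and> y \<in> \<Lambda>2 N R \<and> v \<in> tensor_power N (k - 2 - i)}}"

text \<open>Representatives of elements of the degree \<open>k\<close> component of the exterior algebra.\<close>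

definition \<Lambda>_quot :: "nat set \<Rightarrow> braiding \<Rightarrow> nat \<Rightarrow> talg set" where
  "\<Lambda>_quot N R k = {x. \<exists>y\<in>tensor_power N k. x - y \<in> exterior_ideal N R}"

text \<open>The inverse of the isomorphism \<open>\<pi>\<close> from \<open>\<Lambda>_sub\<close> to the quotient.\<close>

definition pi_inv :: "nat set \<Rightarrow> braiding \<Rightarrow> nat \<Rightarrow> talg \<Rightarrow> talg" where
  "pi_inv N R k x = (THE y. y \<in> \<Lambda>_sub N R k \<and> x - y \<in> exterior_ideal N R)"

definition pairing :: "nat set \<Rightarrow> braiding \<Rightarrow> braiding \<Rightarrow> (nat \<Rightarrow> complex) \<Rightarrow> nat \<Rightarrow> talg \<Rightarrow> talg \<Rightarrow> complex" where
  "pairing N Rm Rp lam k w v = lam k * pairing_T (pi_inv N Rm k w) (pi_inv N Rp k v)"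

text \<open>
  For an ideal \<open>J\<close> of \<open>talg\<close>, the endomorphisms of the vector space \<open>talg / J\<close> are the
  endomorphisms of \<open>talg\<close> preserving \<open>J\<close>, modulo those with values in \<open>J\<close>.
\<close>

definition Cl :: "talg set \<Rightarrow> nat fword endo set"
  where "Cl J = {\<phi>. \<forall>x\<in>J. app_endo \<phi> x \<in> J}"

definition Cl_null :: "talg set \<Rightarrow> nat fword endo set"
  where "Cl_null J = {\<phi>. \<forall>x. app_endo \<phi> x \<in> J}"

definition contraction ::
    "nat set \<Rightarrow> braiding \<Rightarrow> braiding \<Rightarrow> (nat \<Rightarrow> complex) \<Rightarrow> talg \<Rightarrow> nat fword endo \<Rightarrow> bool" where
  "contraction N Rm Rp lam z \<gamma> \<longleftrightarrow>
     \<gamma> \<in> Cl (exterior_ideal N Rp) \<and>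
     app_endo \<gamma> 1 \<in> exterior_ideal N Rp \<and>
     (\<forall>k. \<forall>v\<in>tensor_power N (Suc k).
        app_endo \<gamma> v \<in> \<Lambda>_quot N Rp k \<and>
        (\<forall>w\<in>tensor_power N k.
           pairing N Rm Rp lam k w (app_endo \<gamma> v) = pairing N Rm Rp lam (Suc k) (w * z) v))"

text \<open>A Hermitian inner product on \<open>talg / J\<close>, conjugate-linear in the first variable.\<close>

definition hermitian_inner_product :: "talg set \<Rightarrow> (talg \<Rightarrow> talg \<Rightarrow> complex) \<Rightarrow> bool" where
  "hermitian_inner_product J ip \<longleftrightarrow>
     (\<forall>x y z. ip x (y + z) = ip x y + ip x z) \<and>
     (\<forall>c x y. ip x (c *\<^sub>C y) = c * ip x y) \<and>
     (\<forall>x y. ip y x = cnj (ip x y)) \<and>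
     (\<forall>x y. y \<in> J \<longrightarrow> ip x y = 0) \<and>
     (\<forall>x. x \<notin> J \<longrightarrow> 0 < Re (ip x x))"



definition adjoint_endo ::
    "talg set \<Rightarrow> (talg \<Rightarrow> talg \<Rightarrow> complex) \<Rightarrow> nat fword endo \<Rightarrow> nat fword endo \<Rightarrow> bool" where
  "adjoint_endo J ip \<phi> \<phi>' \<longleftrightarrow>
     \<phi>' \<in> Cl J \<and> (\<forall>x y. ip (app_endo \<phi>' x) y = ip x (app_endo \<phi> y))"


section \<open>Quantized flag manifolds and Dolbeault-Dirac operators\<close>

locale quantum_flag =
  fixes q :: real
    and r :: nat
    and gram :: "nat \<Rightarrow> nat \<Rightarrow> int"
    and roots :: "lattice set"
    and t :: nat
begin

definition q_power :: "int \<Rightarrow> complex"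
  where "q_power n = of_real (q powi n)"

definition qi_power :: "nat \<Rightarrow> int \<Rightarrow> complex"
  where "qi_power i n = q_power (half_norm gram i * n)"

definition q_integer :: "nat \<Rightarrow> nat \<Rightarrow> complex" where
  "q_integer i n = (qi_power i (int n) - qi_power i (- int n)) / (qi_power i 1 - qi_power i (- 1))"

definition divided_power :: "nat \<Rightarrow> galg \<Rightarrow> nat \<Rightarrow> galg"
  where "divided_power i x n = (1 / (\<Prod>m=1..n. q_integer i m)) *\<^sub>C x ^ n"

definition serre :: "nat \<Rightarrow> nat \<Rightarrow> galg \<Rightarrow> galg \<Rightarrow> galg" where
  "serre i j x y = (\<Sum>s\<le>nat (1 - cartan gram i j).
     (- 1) ^ s *\<^sub>C (divided_power i x (nat (1 - cartan gram i j) - s) * y * divided_power i x s))"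

text \<open>
  The quantized enveloping algebra is \<open>galg\<close> modulo \<open>Uq_ideal\<close>; the superfluous generators
  with indices \<open>\<ge> r\<close> are sent to \<open>0\<close>.
\<close>

definition Uq_ideal :: "galg set" where
  "Uq_ideal = ideal_generated (
       {eK i * eK j - eK j * eK i | i j. i < r \<and> j < r}
     \<union> {eK i * eKi i - 1 | i. i < r}
     \<union> {eKi i * eK i - 1 | i. i < r}
     \<union> {eK i * eE j * eKi i - qi_power i (cartan gram i j) *\<^sub>C eE j | i j. i < r \<and> j < r}
     \<union> {eK i * eF j * eKi i - qi_power i (- cartan gram i j) *\<^sub>C eF j | i j. i < r \<and> j < r}
     \<union> {eE i * eF j - eF j * eE i
          - (if i = j then (1 / (qi_power i 1 - qi_power i (- 1))) *\<^sub>C (eK i - eKi i) else 0)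
        | i j. i < r \<and> j < r}
     \<union> {serre i j (eE i) (eE j) | i j. i < r \<and> j < r \<and> i \<noteq> j}
     \<union> {serre i j (eF i) (eF j) | i j. i < r \<and> j < r \<and> i \<noteq> j}
     \<union> {letter a | a. \<exists>i\<ge>r. a \<in> {GE i, GF i, GK i, GKi i}})"

definition center :: "galg set"
  where "center = {c. \<forall>x. c * x - x * c \<in> Uq_ideal}"

definition levi_gens :: "gen set" where
  "levi_gens = {GK i | i. i < r} \<union> {GKi i | i. i < r}
     \<union> {GE j | j. j < r \<and> j \<noteq> t} \<union> {GF j | j. j < r \<and> j \<noteq> t}"

text \<open>
  \<open>levi_free\<close> consists of the noncommutative polynomials in the generators of the Levi factor;
  \<open>Uq_levi\<close> is the full preimage in \<open>galg\<close> of the quantized Levi factor.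
\<close>

definition levi_free :: "galg set"
  where "levi_free = {x. \<forall>w\<in>keys x. set (letters w) \<subseteq> levi_gens}"

definition Uq_levi :: "galg set"
  where "Uq_levi = {x. \<exists>y\<in>levi_free. x - y \<in> Uq_ideal}"

text \<open>Lusztig's automorphism \<open>T\<^sub>i\<close>, lifted to the free algebra.\<close>

fun lusztig_gen :: "nat \<Rightarrow> gen \<Rightarrow> galg" where
  "lusztig_gen i (GK j) = eK j * K_power i (- cartan gram i j)"
| "lusztig_gen i (GKi j) = eKi j * K_power i (cartan gram i j)"
| "lusztig_gen i (GE j) =
     (if j = i then - (eF i * eK i)
      else \<Sum>s\<le>nat (- cartan gram i j). ((- 1) ^ s * qi_power i (- int s)) *\<^sub>C
        (divided_power i (eE i) (nat (- cartan gram i j) - s) * eE j * divided_power i (eE i) s))"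
| "lusztig_gen i (GF j) =
     (if j = i then - (eKi i * eE i)
      else \<Sum>s\<le>nat (- cartan gram i j). ((- 1) ^ s * qi_power i (int s)) *\<^sub>C
        (divided_power i (eF i) s * eF j * divided_power i (eF i) (nat (- cartan gram i j) - s)))"

definition lusztig :: "nat \<Rightarrow> galg \<Rightarrow> galg"
  where "lusztig i = alg_hom (lusztig_gen i)"

definition radical_roots :: "lattice set" where
  "radical_roots = {\<beta>\<in>roots. nonneg \<beta>} - {\<beta>\<in>roots. keys \<beta> \<subseteq> {..<r} - {t}}"

definition admissible_word :: "nat list \<Rightarrow> bool" where
  "admissible_word ws \<longleftrightarrow>
     longest_word r gram {..<r} ws \<and>
     (\<exists>m\<le>length ws. longest_word r gram ({..<r} - {t}) (take m ws))"

definition beta :: "nat list \<Rightarrow> nat \<Rightarrow> lattice"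
  where "beta ws k = weyl r gram (take k ws) (simple_root (ws ! k))"

definition root_vector :: "nat list \<Rightarrow> nat \<Rightarrow> galg"
  where "root_vector ws k = foldr lusztig (take k ws) (eE (ws ! k))"

text \<open>
  The radical roots \<open>\<xi>\<close>, and with them the basis vectors of \<open>u\<^sub>\<plusminus>\<close>, are indexed by the positions
  \<open>k\<close> with \<open>\<beta>\<^sub>k\<close> radical.
\<close>

definition indices :: "nat list \<Rightarrow> nat set"
  where "indices ws = {k. k < length ws \<and> beta ws k \<in> radical_roots}"

definition levi_action :: "nat set \<Rightarrow> action \<Rightarrow> bool" where
  "levi_action N \<rho> \<longleftrightarrow> (\<forall>j\<in>N.
     (\<forall>X\<in>levi_free. \<rho> X j \<in> tensor_power N 1) \<and>
     (\<forall>X\<in>levi_free. \<forall>Y\<in>levi_free. \<rho> (X + Y) j = \<rho> X j + \<rho> Y j) \<and>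
     (\<forall>c. \<forall>X\<in>levi_free. \<rho> (c *\<^sub>C X) j = c *\<^sub>C \<rho> X j) \<and>
     \<rho> 1 j = letter j \<and>
     (\<forall>X\<in>levi_free. \<forall>Y\<in>levi_free. \<rho> (X * Y) j = lin_ext (\<lambda>l. \<rho> X (l ! 0)) (\<rho> Y j)) \<and>
     (\<forall>X\<in>levi_free \<inter> Uq_ideal. \<rho> X j = 0))"

text \<open>\<open>u\<^sub>+\<close>: the letter \<open>j\<close> stands for the root vector \<open>root_vector ws j\<close>.\<close>

definition adjoint_action :: "nat list \<Rightarrow> action \<Rightarrow> bool" where
  "adjoint_action ws \<rho> \<longleftrightarrow> levi_action (indices ws) \<rho> \<and>
     (\<forall>X\<in>levi_free. \<forall>j\<in>indices ws.
        adjoint_act X (root_vector ws j) - alg_hom (root_vector ws) (\<rho> X j) \<in> Uq_ideal)"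

text \<open>\<open>u\<^sub>-\<close>: the letter \<open>j\<close> stands for the dual basis vector \<open>w\<^sub>j\<close>.\<close>

definition dual_action :: "nat list \<Rightarrow> action \<Rightarrow> action \<Rightarrow> bool" where
  "dual_action ws \<rho> \<sigma> \<longleftrightarrow> levi_action (indices ws) \<sigma> \<and>
     (\<forall>X\<in>levi_free. \<forall>i\<in>indices ws. \<forall>j\<in>indices ws.
        (\<Sum>p\<in>keys (coproduct X). lookup (coproduct X) p *
            pairing_T (\<sigma> (basis_word (fst p)) i) (\<rho> (basis_word (snd p)) j))
        = counit X * pairing_T (letter i) (letter j))"

definition weight_less :: "lattice \<Rightarrow> lattice \<Rightarrow> bool"
  where "weight_less \<mu> \<nu> \<longleftrightarrow> \<mu> \<noteq> \<nu> \<and> nonneg (\<nu> - \<mu>)"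

definition is_braiding :: "nat set \<Rightarrow> (nat \<Rightarrow> lattice) \<Rightarrow> action \<Rightarrow> braiding \<Rightarrow> bool" where
  "is_braiding N wt \<rho> R \<longleftrightarrow> (\<forall>i\<in>N. \<forall>j\<in>N.
     R i j \<in> tensor_power N 2 \<and>
     (\<forall>X\<in>levi_free. braid R (act \<rho> X (letter i * letter j)) = act \<rho> X (R i j)) \<and>
     R i j - q_power (lattice_form r gram (wt i) (wt j)) *\<^sub>C (letter j * letter i)
       \<in> cvec.span {letter a * letter b | a b. a \<in> N \<and> b \<in> N \<and>
            weight_less (wt j) (wt a) \<and> weight_less (wt b) (wt i)})"

definition invariant_inner_product ::
    "nat set \<Rightarrow> action \<Rightarrow> talg set \<Rightarrow> (talg \<Rightarrow> talg \<Rightarrow> complex) \<Rightarrow> bool" where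
  "invariant_inner_product N \<rho> J ip \<longleftrightarrow>
     hermitian_inner_product J ip \<and>
     (\<forall>k l. k \<noteq> l \<longrightarrow> (\<forall>x\<in>tensor_power N k. \<forall>y\<in>tensor_power N l. ip x y = 0)) \<and>
     (\<forall>X\<in>levi_free. \<forall>x\<in>tensor_algebra N. \<forall>y\<in>tensor_algebra N.
        ip x (act \<rho> X y) = ip (act \<rho> (star X) x) y)"

text \<open>
  \<open>dolbeault_dirac J D\<close>: for some admissible choices, \<open>talg / J\<close> is the quantum exterior algebra
  of \<open>u\<^sub>+\<close> and \<open>D\<close> represents the Dolbeault-Dirac operator.  The actions \<open>\<rho>\<close>, \<open>\<sigma>\<close>, the braidings
  \<open>Rp\<close>, \<open>Rm\<close> and, modulo \<open>Cl_null J\<close>, the operators \<open>\<gamma> k\<close> and their adjoints \<open>\<gamma>' k\<close> are determined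
  by the remaining data.
\<close>

definition dolbeault_dirac :: "talg set \<Rightarrow> (gen fword \<Rightarrow>\<^sub>0 nat fword endo) \<Rightarrow> bool" where
  "dolbeault_dirac J D \<longleftrightarrow> (\<exists>ws \<rho> \<sigma> Rp Rm lam ip \<gamma> \<gamma>'.
     admissible_word ws \<and>
     adjoint_action ws \<rho> \<and>
     dual_action ws \<rho> \<sigma> \<and>
     is_braiding (indices ws) (beta ws) \<rho> Rp \<and>
     is_braiding (indices ws) (\<lambda>k. - beta ws k) \<sigma> Rm \<and>
     J = exterior_ideal (indices ws) Rp \<and>
     (\<forall>k. lam k \<noteq> 0) \<and>
     invariant_inner_product (indices ws) \<rho> J ip \<and>
     (\<forall>k\<in>indices ws. contraction (indices ws) Rm Rp lam (letter k) (\<gamma> k) \<and>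
                      adjoint_endo J ip (\<gamma> k) (\<gamma>' k)) \<and>
     D = (\<Sum>k\<in>indices ws. antipode_inv (root_vector ws k) \<otimes>\<^sub>C \<gamma> k)
       + (\<Sum>k\<in>indices ws. star (antipode_inv (root_vector ws k)) \<otimes>\<^sub>C \<gamma>' k))"

text \<open>
  \<open>A \<sim> B\<close>: the difference lies in the tensor product of the quantized Levi factor with
  \<open>End (talg / J)\<close>.  Since \<open>A\<close> and \<open>B\<close> are representatives, tensors vanishing in the tensor
  product are allowed as well (\<open>Uq_ideal \<subseteq> Uq_levi\<close> takes care of the first factor).
\<close>

definition levi_equiv ::
    "talg set \<Rightarrow> (gen fword \<Rightarrow>\<^sub>0 nat fword endo) \<Rightarrow> (gen fword \<Rightarrow>\<^sub>0 nat fword endo) \<Rightarrow> bool" where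
  "levi_equiv J A B \<longleftrightarrow> (\<exists>(n::nat) a s.
     (\<forall>i<n. (a i \<in> Uq_levi \<and> s i \<in> Cl J) \<or> s i \<in> Cl_null J) \<and>
     A - B = (\<Sum>i<n. a i \<otimes>\<^sub>C s i))"

end

end

theory Submission
  imports Defs
begin

text \<open>
  The smallest irreducible flag manifold, the projective line, is already a counterexample.
  For \<open>g = sl\<^sub>2\<close> the quantized Levi factor is the algebra of Laurent polynomials in
  \<open>K\<close>, the radical \<open>u\<^sub>+\<close> is the line spanned by \<open>E\<close>, and, as \<open>S\<^sup>-\<^sup>1(E) = - E K\<^sup>-\<^sup>1\<close> and
  \<open>(E K\<^sup>-\<^sup>1)\<^sup>* = F\<close>, every Dolbeault-Dirac operator is \<open>D = - E K\<^sup>-\<^sup>1 \<otimes> \<gamma> - F \<otimes> \<gamma>\<^sup>*\<close>.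
  Up to Cartan terms \<open>D\<^sup>2\<close> therefore contains the quadratic Casimir element only in the
  combination Casimir times \<open>K\<^sup>-\<^sup>1\<close>, and the factor \<open>K\<^sup>-\<^sup>1\<close> cannot be absorbed.

  To turn this into a proof, apply the vacuum state \<open>s \<mapsto> (1, s 1)\<close> to the Clifford factor.  Since
  \<open>\<gamma> 1 = 0\<close>, only the term of \<open>\<gamma> \<gamma>\<^sup>*\<close> survives, so that \<open>D\<^sup>2\<close> becomes \<open>c E K\<^sup>-\<^sup>1 F\<close> with
  \<open>c\<close> the squared norm of \<open>\<gamma>\<^sup>* 1\<close>.  This number is nonzero because contraction by the dual
  basis vector sends the generator of \<open>u\<^sub>+\<close> to a nonzero scalar
  (\<open>vacuum_state_contraction_times_adjoint\<close>); here it matters that the relations of the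
  exterior algebra start in degree two.  A formula \<open>D\<^sup>2 \<sim> \<Sum> C\<^sub>i \<otimes> T\<^sub>i\<close> would thus make
  \<open>c E K\<^sup>-\<^sup>1 F\<close> congruent to a central element \<open>Z\<close> modulo the Levi factor.

  This is refuted by a one-parameter family of weight modules \<open>M\<^sub>a\<close> with basis \<open>m\<^sub>n\<close>, \<open>n\<close> an
  integer, on which \<open>F\<close> acts as the shift \<open>m\<^sub>n \<mapsto> m\<^sub>n\<^sub>+\<^sub>1\<close>, \<open>K\<close> by \<open>q\<^sup>-\<^sup>2\<^sup>n\<close>, and the Casimir element
  by the free parameter \<open>a\<close>.  The Levi factor acts on all \<open>M\<^sub>a\<close> by the same operators, so the
  difference of \<open>c E K\<^sup>-\<^sup>1 F\<close> on \<open>M\<^sub>1\<close> and on \<open>M\<^sub>0\<close>, which is \<open>c K\<^sup>-\<^sup>1\<close> up to a power of \<open>q\<close>,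
  equals the difference of the actions of \<open>Z\<close>.  The latter commutes with \<open>F\<close>, the
  former does not (\<open>E_Kinv_F_not_central_mod_levi\<close>).
\<close>

section \<open>The Lie algebra of type A1\<close>

text \<open>The coordinates \<open>0\<close>, \<open>1\<close>, \<open>2\<close> belong to the standard basis \<open>e\<close>, \<open>h\<close>, \<open>f\<close>.\<close>

definition sl2 :: "vec set"
  where "sl2 = {x. keys x \<subseteq> {0, 1, 2}}"

definition sl2_bracket :: "vec \<Rightarrow> vec \<Rightarrow> vec" where
  "sl2_bracket x y =
       Poly_Mapping.single 0 (2 * (lookup x 1 * lookup y 0 - lookup x 0 * lookup y 1))
     + Poly_Mapping.single 1 (lookup x 0 * lookup y 2 - lookup x 2 * lookup y 0)
     + Poly_Mapping.single 2 (2 * (lookup x 2 * lookup y 1 - lookup x 1 * lookup y 2))"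

definition sl2_cartan :: "vec set"
  where "sl2_cartan = {x. keys x \<subseteq> {1}}"

definition sl2_root :: "nat \<Rightarrow> vec \<Rightarrow> complex"
  where "sl2_root i y = 2 * lookup y 1"

text \<open>The trace of the product of two matrices in the defining representation.\<close>

definition sl2_trace_form :: "vec \<Rightarrow> vec \<Rightarrow> complex" where
  "sl2_trace_form x y = 2 * lookup x 1 * lookup y 1 + lookup x 0 * lookup y 2 + lookup x 2 * lookup y 0"

lemma lookup_sl2_bracket:
  "lookup (sl2_bracket x y) k =
    (if k = 0 then 2 * (lookup x 1 * lookup y 0 - lookup x 0 * lookup y 1)
     else if k = 1 then lookup x 0 * lookup y 2 - lookup x 2 * lookup y 0
     else if k = 2 then 2 * (lookup x 2 * lookup y 1 - lookup x 1 * lookup y 2)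
     else 0)"
  by (auto simp: sl2_bracket_def lookup_add lookup_single lookup_one when_def)

lemma sl2_iff: "x \<in> sl2 \<longleftrightarrow> (\<forall>k. k \<noteq> 0 \<longrightarrow> k \<noteq> 1 \<longrightarrow> k \<noteq> 2 \<longrightarrow> lookup x k = 0)"
  by (auto simp: sl2_def in_keys_iff subset_iff)

lemma sl2_cartan_iff: "x \<in> sl2_cartan \<longleftrightarrow> (\<forall>k. k \<noteq> 1 \<longrightarrow> lookup x k = 0)"
  by (auto simp: sl2_cartan_def in_keys_iff subset_iff)

lemma sl2_eqI:
  assumes "x \<in> sl2" "y \<in> sl2" "lookup x 0 = lookup y 0" "lookup x 1 = lookup y 1" "lookup x 2 = lookup y 2"
  shows "x = y"
proof (rule poly_mapping_eqI)
  fix k show "lookup x k = lookup y k"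
    using assms by (cases "k = 0 \<or> k = 1 \<or> k = 2") (auto simp: sl2_iff)
qed

lemma sl2_coordinates:
  assumes "x \<in> sl2"
  shows "x = lookup x 0 *\<^sub>C Poly_Mapping.single 0 1 + lookup x 1 *\<^sub>C Poly_Mapping.single 1 1
           + lookup x 2 *\<^sub>C Poly_Mapping.single 2 1"
  by (rule sl2_eqI[OF assms]) (auto simp: sl2_iff lookup_add lookup_single lookup_one when_def)

lemma bracket_in_sl2 [simp]: "sl2_bracket x y \<in> sl2"
  by (simp add: sl2_iff lookup_sl2_bracket)

lemma subspace_sl2: "cvec.subspace sl2"
  by (rule cvec.subspaceI) (auto simp: sl2_iff lookup_add)

lemma sl2_eq_span:
  "sl2 = cvec.span {Poly_Mapping.single 0 1, Poly_Mapping.single 1 1, Poly_Mapping.single 2 1}"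
proof
  show "sl2 \<subseteq> cvec.span {Poly_Mapping.single 0 1, Poly_Mapping.single 1 1, Poly_Mapping.single 2 1}"
  proof
    fix x assume "x \<in> sl2"
    show "x \<in> cvec.span {Poly_Mapping.single 0 1, Poly_Mapping.single 1 1, Poly_Mapping.single 2 1}"
      by (subst sl2_coordinates[OF \<open>x \<in> sl2\<close>])
         (intro cvec.span_add cvec.span_scale cvec.span_base; simp)
  qed
  show "cvec.span {Poly_Mapping.single 0 1, Poly_Mapping.single 1 1, Poly_Mapping.single 2 1} \<subseteq> sl2"
    by (rule cvec.span_minimal[OF _ subspace_sl2]) (auto simp: sl2_iff lookup_single lookup_one when_def)
qed

lemma lie_algebra_sl2: "lie_algebra sl2 sl2_bracket"
  unfolding lie_algebra_def
proof (intro conjI)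
  show "\<exists>B. finite B \<and> sl2 = cvec.span B"
    by (rule exI[of _ "{Poly_Mapping.single 0 1, Poly_Mapping.single 1 1, Poly_Mapping.single 2 1}"])
       (simp only: sl2_eq_span finite.intros simp_thms)
qed (safe; (rule bracket_in_sl2 | (rule poly_mapping_eqI, simp add: lookup_sl2_bracket lookup_add algebra_simps)))+

lemma simple_lie_algebra_sl2: "simple_lie_algebra sl2 sl2_bracket"
  unfolding simple_lie_algebra_def
proof (intro conjI allI impI lie_algebra_sl2)
  let ?e = "Poly_Mapping.single 0 1 :: vec"
  let ?h = "Poly_Mapping.single 1 1 :: vec"
  let ?f = "Poly_Mapping.single 2 1 :: vec"
  have efh: "?e \<in> sl2" "?f \<in> sl2" "?h \<in> sl2"
    by (auto simp: sl2_iff lookup_single lookup_one when_def)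
  have "lookup (sl2_bracket ?e ?f) 1 \<noteq> 0"
    by (simp add: lookup_sl2_bracket lookup_single lookup_one when_def)
  then have "sl2_bracket ?e ?f \<noteq> 0"
    by (metis lookup_zero)
  with efh show "\<exists>x\<in>sl2. \<exists>y\<in>sl2. sl2_bracket x y \<noteq> 0"
    by blast
  fix I assume I: "cvec.subspace I \<and> I \<subseteq> sl2 \<and> (\<forall>x\<in>sl2. \<forall>y\<in>I. sl2_bracket x y \<in> I)"
  then have sub: "cvec.subspace I" and br: "\<And>x y. x \<in> sl2 \<Longrightarrow> y \<in> I \<Longrightarrow> sl2_bracket x y \<in> I"
    by auto
  have divide: "x \<in> I" if "c *\<^sub>C x \<in> I" "c \<noteq> 0" for c x
    using cvec.subspace_scale[OF sub that(1), of "1 / c"] that(2) by simp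
  show "I = {0} \<or> I = sl2"
  proof (cases "I = {0}")
    case False
    then obtain y where y: "y \<in> I" "y \<noteq> 0"
      using cvec.subspace_0[OF sub] by blast
    then have ys: "y \<in> sl2" using I by blast
    (* ad e is nilpotent with kernel spanned by e: the last nonzero iterate on y is a multiple of e. *)
    have ee: "sl2_bracket ?e (sl2_bracket ?e y) = (- 2 * lookup y 2) *\<^sub>C ?e"
      by (rule poly_mapping_eqI) (simp add: lookup_sl2_bracket lookup_single lookup_one when_def)
    have e: "?e \<in> I"
    proof (cases "lookup y 2 = 0")
      case False
      then show ?thesis
        using divide[of "- 2 * lookup y 2" ?e] br[OF efh(1) br[OF efh(1) y(1)]] ee by simp
    next
      case c0: True
      then have eb: "sl2_bracket ?e y = (- 2 * lookup y 1) *\<^sub>C ?e"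
        by (intro poly_mapping_eqI) (simp add: lookup_sl2_bracket lookup_single lookup_one when_def)
      show ?thesis
      proof (cases "lookup y 1 = 0")
        case False
        then show ?thesis
          using divide[of "- 2 * lookup y 1" ?e] br[OF efh(1) y(1)] eb by simp
      next
        case True
        have "y = lookup y 0 *\<^sub>C ?e"
          using sl2_coordinates[OF ys] c0 True by simp
        moreover from this y(2) have "lookup y 0 \<noteq> 0"
          by (metis cvec.scale_zero_left)
        ultimately show ?thesis
          using divide[of "lookup y 0" ?e] y(1) by simp
      qed
    qed
    (* Lowering e produces the rest of the basis. *)
    have "sl2_bracket ?f ?e = (- 1) *\<^sub>C ?h"
      by (rule poly_mapping_eqI) (simp add: lookup_sl2_bracket lookup_single lookup_one when_def)
    then have h: "?h \<in> I"
      using divide[of "- 1" ?h] br[OF efh(2) e] by simp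
    have "sl2_bracket ?f ?h = 2 *\<^sub>C ?f"
      by (rule poly_mapping_eqI) (simp add: lookup_sl2_bracket lookup_single lookup_one when_def)
    then have f: "?f \<in> I"
      using divide[of 2 ?f] br[OF efh(2) h] by simp
    have "sl2 \<subseteq> I"
      unfolding sl2_eq_span by (rule cvec.span_minimal[OF _ sub]) (use e h f in auto)
    then show ?thesis using I by blast
  qed simp
qed

lemma cartan_subalgebra_sl2: "cartan_subalgebra sl2 sl2_bracket sl2_cartan"
  unfolding cartan_subalgebra_def
proof (intro conjI)
  show "cvec.subspace sl2_cartan"
    by (rule cvec.subspaceI) (auto simp: sl2_cartan_iff lookup_add)
  show "sl2_cartan \<subseteq> sl2"
    by (auto simp: sl2_cartan_iff sl2_iff)
  have abelian: "sl2_bracket x y = 0" if "x \<in> sl2_cartan" "y \<in> sl2_cartan" for x y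
    using that by (intro poly_mapping_eqI) (simp add: lookup_sl2_bracket sl2_cartan_iff)
  then show "\<forall>x\<in>sl2_cartan. \<forall>y\<in>sl2_cartan. sl2_bracket x y \<in> sl2_cartan"
    by (simp add: sl2_cartan_iff)
  have "{sl2_bracket x y | x y. x \<in> sl2_cartan \<and> y \<in> sl2_cartan} \<subseteq> {0}"
    by (auto simp: abelian)
  then have "cvec.span {sl2_bracket x y | x y. x \<in> sl2_cartan \<and> y \<in> sl2_cartan} = {0}"
    by (intro equalityI cvec.span_minimal) (auto simp: cvec.span_zero)
  then show "\<exists>n. lower_central_series sl2_bracket sl2_cartan n = {0}"
    by (intro exI[of _ "Suc 0"]) simp
  show "{x \<in> sl2. \<forall>y\<in>sl2_cartan. sl2_bracket x y \<in> sl2_cartan} = sl2_cartan"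
  proof (intro equalityI subsetI)
    fix x assume x: "x \<in> {x \<in> sl2. \<forall>y\<in>sl2_cartan. sl2_bracket x y \<in> sl2_cartan}"
    have "Poly_Mapping.single 1 1 \<in> sl2_cartan"
      by (simp add: sl2_cartan_iff lookup_single lookup_one when_def)
    with x have "sl2_bracket x (Poly_Mapping.single 1 1) \<in> sl2_cartan"
      by blast
    then have "lookup (sl2_bracket x (Poly_Mapping.single 1 1)) 0 = 0"
      "lookup (sl2_bracket x (Poly_Mapping.single 1 1)) 2 = 0"
      by (auto simp: sl2_cartan_iff)
    then have "lookup x 0 = 0" "lookup x 2 = 0"
      by (auto simp: lookup_sl2_bracket lookup_single lookup_one when_def)
    then show "x \<in> sl2_cartan"
      using x unfolding sl2_cartan_iff sl2_iff mem_Collect_eq by metis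
  next
    fix x assume "x \<in> sl2_cartan"
    then show "x \<in> {x \<in> sl2. \<forall>y\<in>sl2_cartan. sl2_bracket x y \<in> sl2_cartan}"
      by (auto simp: abelian) (auto simp: sl2_cartan_iff sl2_iff)
  qed
qed

text \<open>
  A root vector has a nonzero coordinate at \<open>e\<close> or \<open>f\<close>, as its \<open>h\<close>-coordinate would have
  eigenvalue zero; comparing that coordinate fixes the root.
\<close>

lemma is_root_sl2:
  "is_root sl2 sl2_bracket sl2_cartan \<mu> \<longleftrightarrow>
    (\<forall>y\<in>sl2_cartan. \<mu> y = 2 * lookup y 1) \<or> (\<forall>y\<in>sl2_cartan. \<mu> y = - 2 * lookup y 1)"
  (is "?L \<longleftrightarrow> ?R")
proof
  assume ?L
  then obtain y0 x where y0: "y0 \<in> sl2_cartan" "\<mu> y0 \<noteq> 0" and x: "x \<in> sl2" "x \<noteq> 0"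
    and ev: "\<And>y. y \<in> sl2_cartan \<Longrightarrow> sl2_bracket y x = \<mu> y *\<^sub>C x"
    by (auto simp: is_root_def)
  have co: "2 * lookup y 1 * lookup x 0 = \<mu> y * lookup x 0" "0 = \<mu> y * lookup x 1"
    "(- 2 * lookup y 1) * lookup x 2 = \<mu> y * lookup x 2" if "y \<in> sl2_cartan" for y
    using arg_cong[OF ev[OF that], of "\<lambda>z. lookup z 0"] arg_cong[OF ev[OF that], of "\<lambda>z. lookup z 1"]
      arg_cong[OF ev[OF that], of "\<lambda>z. lookup z 2"] that
    by (simp_all add: lookup_sl2_bracket sl2_cartan_iff mult.assoc)
  have "lookup x 1 = 0" using co(2)[OF y0(1)] y0(2) by simp
  then have "lookup x 0 \<noteq> 0 \<or> lookup x 2 \<noteq> 0"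
    using sl2_eqI[OF x(1), of 0] x(2) by (auto simp: sl2_iff)
  then show ?R
  proof
    assume "lookup x 0 \<noteq> 0"
    then show ?R using co(1) by simp
  next
    assume "lookup x 2 \<noteq> 0"
    then have "\<mu> y = - 2 * lookup y 1" if "y \<in> sl2_cartan" for y
      using co(3)[OF that] by (metis mult_right_cancel)
    then show ?R by blast
  qed
next
  have h: "Poly_Mapping.single 1 1 \<in> sl2_cartan"
    by (simp add: sl2_cartan_iff lookup_single lookup_one when_def)
  have ne: "Poly_Mapping.single 0 1 \<noteq> (0::vec)" "Poly_Mapping.single 2 1 \<noteq> (0::vec)"
    by (metis lookup_single_eq lookup_zero zero_neq_one)+
  assume ?R
  then show ?L
  proof
    assume *: "\<forall>y\<in>sl2_cartan. \<mu> y = 2 * lookup y 1"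
    have "\<mu> (Poly_Mapping.single 1 1) \<noteq> 0"
      using * h by (simp add: lookup_single lookup_one when_def)
    moreover have "\<forall>y\<in>sl2_cartan. sl2_bracket y (Poly_Mapping.single 0 1) = \<mu> y *\<^sub>C Poly_Mapping.single 0 1"
      using * by (auto intro!: poly_mapping_eqI simp: lookup_sl2_bracket lookup_single lookup_one when_def sl2_cartan_iff)
    ultimately show ?L
      unfolding is_root_def using h ne(1)
      by (intro conjI bexI[of _ "Poly_Mapping.single 1 1"] bexI[of _ "Poly_Mapping.single 0 1"])
         (auto simp: sl2_iff lookup_single lookup_one when_def)
  next
    assume *: "\<forall>y\<in>sl2_cartan. \<mu> y = - 2 * lookup y 1"
    have "\<mu> (Poly_Mapping.single 1 1) \<noteq> 0"
      using * h by (simp add: lookup_single lookup_one when_def)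
    moreover have "\<forall>y\<in>sl2_cartan. sl2_bracket y (Poly_Mapping.single 2 1) = \<mu> y *\<^sub>C Poly_Mapping.single 2 1"
      using * by (auto intro!: poly_mapping_eqI simp: lookup_sl2_bracket lookup_single lookup_one when_def sl2_cartan_iff)
    ultimately show ?L
      unfolding is_root_def using h ne(2)
      by (intro conjI bexI[of _ "Poly_Mapping.single 1 1"] bexI[of _ "Poly_Mapping.single 2 1"])
         (auto simp: sl2_iff lookup_single lookup_one when_def)
  qed
qed

lemma functional_sl2: "functional (Suc 0) sl2_root \<beta> y = of_int (lookup \<beta> 0) * (2 * lookup y 1)"
  by (simp add: functional_def sl2_root_def)

lemma roots_sl2:
  "\<beta> \<in> roots sl2 sl2_bracket sl2_cartan (Suc 0) sl2_root \<longleftrightarrow>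
    keys \<beta> \<subseteq> {0} \<and> (lookup \<beta> 0 = 1 \<or> lookup \<beta> 0 = - 1)"
proof -
  have h: "Poly_Mapping.single 1 1 \<in> sl2_cartan"
    by (simp add: sl2_cartan_iff lookup_single lookup_one when_def)
  have plus: "(\<forall>y\<in>sl2_cartan. functional (Suc 0) sl2_root \<beta> y = 2 * lookup y 1) \<longleftrightarrow> lookup \<beta> 0 = 1"
    using h by (auto simp: functional_sl2 lookup_single dest!: bspec)
  have "(\<forall>y\<in>sl2_cartan. functional (Suc 0) sl2_root \<beta> y = - 2 * lookup y 1) \<longleftrightarrow> lookup \<beta> 0 = - 1"
  proof
    assume "\<forall>y\<in>sl2_cartan. functional (Suc 0) sl2_root \<beta> y = - 2 * lookup y 1"
    from bspec[OF this h] have "complex_of_int (lookup \<beta> 0) = of_int (- 1)"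
      by (simp add: functional_sl2 lookup_single lookup_one when_def)
    then show "lookup \<beta> 0 = - 1" by (simp only: of_int_eq_iff)
  qed (simp add: functional_sl2)
  with plus show ?thesis
    by (auto simp: roots_def is_root_sl2 lessThan_Suc)
qed

lemma simple_roots_sl2: "simple_roots sl2 sl2_bracket sl2_cartan (Suc 0) sl2_root"
  unfolding simple_roots_def
proof (intro conjI allI impI)
  fix i :: nat assume "i < Suc 0"
  show "is_root sl2 sl2_bracket sl2_cartan (sl2_root i)"
    by (simp add: is_root_sl2 sl2_root_def)
next
  fix c :: "nat \<Rightarrow> complex" and i :: nat
  assume "\<forall>y\<in>sl2_cartan. (\<Sum>i<Suc 0. c i * sl2_root i y) = 0" "i < Suc 0"
  moreover have "Poly_Mapping.single 1 1 \<in> sl2_cartan"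
    by (simp add: sl2_cartan_iff lookup_single lookup_one when_def)
  ultimately show "c i = 0"
    by (fastforce simp: sl2_root_def lookup_single lookup_one when_def)
next
  fix \<mu> assume "is_root sl2 sl2_bracket sl2_cartan \<mu>"
  then consider "\<forall>y\<in>sl2_cartan. \<mu> y = 2 * lookup y 1" | "\<forall>y\<in>sl2_cartan. \<mu> y = - 2 * lookup y 1"
    by (auto simp: is_root_sl2)
  then show "\<exists>\<beta>. keys \<beta> \<subseteq> {..<Suc 0} \<and> (nonneg \<beta> \<or> nonneg (- \<beta>)) \<and>
      (\<forall>y\<in>sl2_cartan. \<mu> y = functional (Suc 0) sl2_root \<beta> y)"
  proof cases
    case 1
    then show ?thesis
      by (intro exI[of _ "simple_root 0"])
         (auto simp: simple_root_def functional_sl2 nonneg_def lookup_single lookup_one when_def)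
  next
    case 2
    then show ?thesis
      by (intro exI[of _ "- simple_root 0"])
         (auto simp: simple_root_def functional_sl2 nonneg_def lookup_single lookup_one when_def)
  qed
qed

lemma usual_form_sl2: "usual_form sl2 sl2_bracket sl2_cartan (Suc 0) sl2_root (\<lambda>i j. 2)"
  unfolding usual_form_def
proof (intro conjI)
  let ?h = "Poly_Mapping.single 1 1 :: vec"
  have nondegenerate: "x = 0" if x: "x \<in> sl2" and *: "\<forall>y\<in>sl2. sl2_trace_form x y = 0" for x
  proof -
    have "Poly_Mapping.single k 1 \<in> sl2" if "k \<in> {0, 1, 2}" for k
      using that by (auto simp: sl2_iff lookup_single lookup_one when_def)
    then have "sl2_trace_form x (Poly_Mapping.single k 1) = 0" if "k \<in> {0, 1, 2}" for k
      using * that by blast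
    from this[of 0] this[of 1] this[of 2]
    have "lookup x 2 = 0" "lookup x 1 = 0" "lookup x 0 = 0"
      by (auto simp: sl2_trace_form_def lookup_single lookup_one when_def)
    then show "x = 0"
      using sl2_eqI[OF x, of 0] by (auto simp: sl2_iff)
  qed
  have "invariant_form sl2 sl2_bracket sl2_trace_form"
    unfolding invariant_form_def
    by (intro conjI ballI allI impI nondegenerate)
       (auto simp: sl2_trace_form_def lookup_add lookup_sl2_bracket algebra_simps)
  then show "\<exists>B \<tau>. invariant_form sl2 sl2_bracket B \<and>
      (\<forall>i<Suc 0. \<tau> i \<in> sl2_cartan \<and> (\<forall>y\<in>sl2_cartan. B (\<tau> i) y = sl2_root i y)) \<and>
      (\<forall>i<Suc 0. \<forall>j<Suc 0. of_int 2 = B (\<tau> i) (\<tau> j))"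
    by (intro exI[of _ sl2_trace_form] exI[of _ "\<lambda>_. ?h"])
       (auto simp: sl2_trace_form_def sl2_root_def sl2_cartan_iff lookup_single lookup_one when_def)
  show "\<forall>\<beta>\<in>roots sl2 sl2_bracket sl2_cartan (Suc 0) sl2_root. 2 \<le> lattice_form (Suc 0) (\<lambda>i j. 2) \<beta> \<beta>"
    by (auto simp: roots_sl2 lattice_form_def)
  show "\<exists>\<beta>\<in>roots sl2 sl2_bracket sl2_cartan (Suc 0) sl2_root. lattice_form (Suc 0) (\<lambda>i j. 2) \<beta> \<beta> = 2"
    by (rule bexI[of _ "simple_root 0"]) (auto simp: roots_sl2 lattice_form_def simple_root_def)
qed

lemma cominuscule_pair_sl2:
  "cominuscule_pair sl2 sl2_bracket sl2_cartan (Suc 0) sl2_root (\<lambda>i j. 2) 0"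
  unfolding cominuscule_pair_def
proof (intro conjI simple_lie_algebra_sl2 cartan_subalgebra_sl2 simple_roots_sl2 usual_form_sl2)
  have "nonneg (simple_root 0 - \<beta>)" if "\<beta> \<in> roots sl2 sl2_bracket sl2_cartan (Suc 0) sl2_root" for \<beta>
    unfolding nonneg_def
  proof
    fix i show "0 \<le> lookup (simple_root 0 - \<beta>) i"
      using that by (cases "i = 0"; cases "lookup \<beta> i = 0")
        (auto simp: roots_sl2 simple_root_def lookup_minus lookup_single lookup_one when_def subset_iff in_keys_iff)
  qed
  then show "\<exists>\<theta>\<in>roots sl2 sl2_bracket sl2_cartan (Suc 0) sl2_root.
      (\<forall>\<beta>\<in>roots sl2 sl2_bracket sl2_cartan (Suc 0) sl2_root. nonneg (\<theta> - \<beta>)) \<and> lookup \<theta> 0 = 1"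
    by (intro bexI[of _ "simple_root 0"]) (auto simp: roots_sl2 simple_root_def)
qed simp


section \<open>Algebra of tensors and representations\<close>

lemma app_endo_add: "app_endo \<phi> (x + y) = app_endo \<phi> x + app_endo \<phi> y"
  using app_endo[of \<phi>] by (simp add: linear_cscale_iff)

lemma app_endo_cscale: "app_endo \<phi> (c *\<^sub>C x) = c *\<^sub>C app_endo \<phi> x"
  using app_endo[of \<phi>] by (simp add: linear_cscale_iff)

lemma endo_eqI: "(\<And>x. app_endo \<phi> x = app_endo \<psi> x) \<Longrightarrow> \<phi> = \<psi>"
  by (metis app_endo_inject ext)

lemmas app_endo_simps = zero_endo.rep_eq one_endo.rep_eq plus_endo.rep_eq minus_endo.rep_eq
  uminus_endo.rep_eq times_endo.rep_eq scale_endo.rep_eq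

lemma scale_endo_mult_left: "scale_endo c s * t = scale_endo c (s * t)"
  by (rule endo_eqI) (simp add: app_endo_simps)

lemma scale_endo_mult_right: "s * scale_endo c t = scale_endo c (s * t)"
  by (rule endo_eqI) (simp add: app_endo_simps app_endo_cscale)

lemma scale_endo_scale_endo: "scale_endo a (scale_endo b s) = scale_endo (a * b) s"
  by (rule endo_eqI) (simp add: app_endo_simps)

lemma scale_endo_add_left: "scale_endo (a + b) s = scale_endo a s + scale_endo b s"
  by (rule endo_eqI) (simp add: app_endo_simps cvec.scale_left_distrib)

lemma scale_endo_add_right: "scale_endo a (s + t) = scale_endo a s + scale_endo a t"
  by (rule endo_eqI) (simp add: app_endo_simps cvec.scale_right_distrib)

lemma scale_endo_zero [simp]: "scale_endo 0 s = 0" "scale_endo c 0 = 0"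
  by (rule endo_eqI, simp add: app_endo_simps)+

lemma scale_endo_one [simp]: "scale_endo 1 s = s"
  by (rule endo_eqI) (simp add: app_endo_simps)

lemma poly_mapping_additive_induct [case_names single add]:
  assumes "\<And>k c. P (Poly_Mapping.single k c)"
    and "\<And>x y. P x \<Longrightarrow> P y \<Longrightarrow> P (x + y)"
  shows "P (x :: 'k \<Rightarrow>\<^sub>0 'c::comm_monoid_add)"
proof -
  have zero: "P 0" using assms(1)[of _ 0] by simp
  have "P (\<Sum>k\<in>A. Poly_Mapping.single k (lookup x k))" if "finite A" for A
    using that by induction (auto intro: assms zero)
  moreover have "(\<Sum>k\<in>keys x. Poly_Mapping.single k (lookup x k)) = x"
    by (rule poly_mapping_eqI) (auto simp: lookup_sum lookup_single when_def in_keys_iff)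
  ultimately show ?thesis by (metis finite_keys)
qed

lemma lookup_pure_tensor: "lookup (a \<otimes>\<^sub>C s) w = scale_endo (lookup a w) s"
  by (simp add: pure_tensor_def Poly_Mapping.map.rep_eq when_def)

lemma pure_tensor_add_left: "(a + b) \<otimes>\<^sub>C s = a \<otimes>\<^sub>C s + b \<otimes>\<^sub>C s"
  by (rule poly_mapping_eqI) (simp add: lookup_pure_tensor lookup_add scale_endo_add_left)

lemma pure_tensor_single: "Poly_Mapping.single w c \<otimes>\<^sub>C s = Poly_Mapping.single w (scale_endo c s)"
  by (rule poly_mapping_eqI) (simp add: lookup_pure_tensor lookup_single when_def)

lemma pure_tensor_mult: "(a \<otimes>\<^sub>C s) * (b \<otimes>\<^sub>C t) = (a * b) \<otimes>\<^sub>C (s * t)"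
proof (induction a rule: poly_mapping_additive_induct)
  case (single u c)
  show ?case
  proof (induction b rule: poly_mapping_additive_induct)
    case (single v d)
    show ?case
      by (simp add: pure_tensor_single mult_single scale_endo_mult_left scale_endo_mult_right
          scale_endo_scale_endo mult.commute)
  qed (simp add: pure_tensor_add_left distrib_left)
qed (simp add: pure_tensor_add_left distrib_right)

text \<open>
  Functionals on the endomorphisms are used to reduce an identity in the tensor product to
  identities in the first factor.
\<close>

definition endo_functional :: "('k endo \<Rightarrow> complex) \<Rightarrow> bool" where
  "endo_functional f \<longleftrightarrow> (\<forall>s t. f (s + t) = f s + f t) \<and> (\<forall>c s. f (scale_endo c s) = c * f s)"

definition slice :: "('k endo \<Rightarrow> complex) \<Rightarrow> ('a fword \<Rightarrow>\<^sub>0 'k endo) \<Rightarrow> 'a free_alg"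
  where "slice f A = Poly_Mapping.map f A"

context
  fixes f :: "'k endo \<Rightarrow> complex"
  assumes f: "endo_functional f"
begin

lemma lookup_slice: "lookup (slice f A) w = f (lookup A w)"
proof -
  have "f 0 = 0" using f scale_endo_zero(1) unfolding endo_functional_def by (metis mult_zero_left)
  then show ?thesis by (simp add: slice_def Poly_Mapping.map.rep_eq when_def)
qed

lemma slice_pure_tensor: "slice f (a \<otimes>\<^sub>C s) = f s *\<^sub>C a"
  using f by (intro poly_mapping_eqI) (simp add: lookup_slice lookup_pure_tensor endo_functional_def)

lemma slice_add: "slice f (A + B) = slice f A + slice f B"
  using f by (intro poly_mapping_eqI) (simp add: lookup_slice lookup_add endo_functional_def)

lemma slice_minus: "slice f (A - B) = slice f A - slice f B"
  using slice_add[of "A - B" B] by simp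

lemma slice_sum: "slice f (\<Sum>i\<in>I. A i) = (\<Sum>i\<in>I. slice f (A i))"
proof -
  have "slice f 0 = 0" using slice_add[of 0 0] by simp
  then show ?thesis
    by (induction I rule: infinite_finite_induct) (simp_all add: slice_add)
qed

end

text \<open>
  Whether an element of the free algebra lies outside an ideal is detected by representations
  that annihilate the generators of the ideal.
\<close>

definition representation :: "('a \<Rightarrow> 'k endo) \<Rightarrow> 'a free_alg \<Rightarrow> 'k endo" where
  "representation f x = (\<Sum>w\<in>keys x. scale_endo (lookup x w) (prod_list (map f (letters w))))"

lemma representation_superset:
  assumes "finite W" "keys x \<subseteq> W"
  shows "representation f x = (\<Sum>w\<in>W. scale_endo (lookup x w) (prod_list (map f (letters w))))"
  unfolding representation_def
  by (rule sum.mono_neutral_left) (use assms in \<open>auto simp: in_keys_iff\<close>)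

lemma representation_add: "representation f (x + y) = representation f x + representation f y"
proof -
  have "keys (x + y) \<subseteq> keys x \<union> keys y" by (rule keys_add)
  then show ?thesis
    by (simp add: representation_superset[of "keys x \<union> keys y"] lookup_add scale_endo_add_left sum.distrib)
qed

lemma representation_single:
  "representation f (Poly_Mapping.single w c) = scale_endo c (prod_list (map f (letters w)))"
  by (simp add: representation_superset[of "{w}"])

lemma representation_letter [simp]: "representation f (letter a) = f a"
  by (simp add: letter_def representation_single)

lemma representation_one [simp]: "representation f 1 = 1"
proof -
  have "representation f (Poly_Mapping.single 0 1) = 1"
    unfolding representation_single by (simp add: zero_fword_def)
  then show ?thesis by simp
qed

lemma representation_cscale: "representation f (c *\<^sub>C x) = scale_endo c (representation f x)"
proof (induction x rule: poly_mapping_additive_induct)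
  case (single w d)
  have "c *\<^sub>C Poly_Mapping.single w d = Poly_Mapping.single w (c * d)"
    by (rule poly_mapping_eqI) (simp add: lookup_single when_def)
  then show ?case by (simp add: representation_single scale_endo_scale_endo)
qed (simp add: cvec.scale_right_distrib representation_add scale_endo_add_right)

lemma representation_mult: "representation f (x * y) = representation f x * representation f y"
proof (induction x rule: poly_mapping_additive_induct)
  case (single u c)
  show ?case
  proof (induction y rule: poly_mapping_additive_induct)
    case (single v d)
    show ?case
      by (simp add: representation_single mult_single plus_fword_def scale_endo_mult_left
          scale_endo_mult_right scale_endo_scale_endo mult.commute)
  qed (simp add: representation_add distrib_left)
qed (simp add: representation_add distrib_right)

lemma representation_diff: "representation f (x - y) = representation f x - representation f y"
  using representation_add[of f "x - y" y] by simp

lemma representation_zero [simp]: "representation f 0 = 0"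
  by (simp add: representation_def)

lemma representation_sum:
  "representation f (\<Sum>i\<in>I. x i) = (\<Sum>i\<in>I. representation f (x i))"
  by (induction I rule: infinite_finite_induct) (simp_all add: representation_add)

lemma representation_cong:
  assumes "\<And>w a. w \<in> keys x \<Longrightarrow> a \<in> set (letters w) \<Longrightarrow> f a = g a"
  shows "representation f x = representation g x"
  unfolding representation_def
proof (rule sum.cong)
  fix w assume "w \<in> keys x"
  then have "map f (letters w) = map g (letters w)"
    using assms by simp
  then show "scale_endo (lookup x w) (prod_list (map f (letters w))) =
      scale_endo (lookup x w) (prod_list (map g (letters w)))" by (simp only:)
qed simp

lemma representation_ideal_generated:
  assumes "\<And>x. x \<in> G \<Longrightarrow> representation f x = 0" and "x \<in> ideal_generated G"
  shows "representation f x = 0"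
proof -
  have "cvec.subspace {x. representation f x = 0}"
    by (rule cvec.subspaceI) (auto simp: representation_add representation_cscale)
  then have "ideal_generated G \<subseteq> {x. representation f x = 0}"
    unfolding ideal_generated_def
    by (rule cvec.span_minimal[rotated]) (auto simp: representation_mult assms(1))
  then show ?thesis using assms(2) by blast
qed

section \<open>The exterior algebra in degrees zero and one\<close>

text \<open>
  All relations of the exterior algebra either have degree two or contain a letter outside \<open>N\<close>.
  So the words below do not occur in the exterior ideal, and in degrees zero and one the
  projection from tensors to the exterior algebra is injective.
\<close>

definition low_words :: "nat set \<Rightarrow> nat fword set"
  where "low_words N = {w. length (letters w) \<le> 1 \<and> set (letters w) \<subseteq> N}"

lemma subspace_tensor_power: "cvec.subspace (tensor_power N k)"
proof (rule cvec.subspaceI)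
  fix x y assume "x \<in> tensor_power N k" "y \<in> tensor_power N k"
  then show "x + y \<in> tensor_power N k"
    using keys_add[of x y] unfolding tensor_power_def by blast
qed (auto simp: tensor_power_def in_keys_iff)

lemma keys_S2: "x \<in> S2 N R \<Longrightarrow> w \<in> keys x \<Longrightarrow> length (letters w) = 2"
proof -
  assume x: "x \<in> S2 N R" and w: "w \<in> keys x"
  have "cvec.subspace (tensor_power N 2)"
    by (rule subspace_tensor_power)
  then have "S2 N R \<subseteq> tensor_power N 2"
    unfolding S2_def by (rule cvec.span_minimal[rotated]) blast
  then show ?thesis using x w by (auto simp: tensor_power_def)
qed

text \<open>
  A factor of a word in \<open>low_words N\<close> is again one, so that multiplying relations by
  arbitrary words cannot produce them.
\<close>

lemma exterior_ideal_low_words: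
  fixes x :: talg
  assumes "x \<in> exterior_ideal N R"
  shows "keys x \<inter> low_words N = {}"
proof -
  have "cvec.subspace {x :: talg. keys x \<inter> low_words N = {}}"
  proof (rule cvec.subspaceI)
    fix x y :: talg assume "x \<in> {x. keys x \<inter> low_words N = {}}" "y \<in> {x. keys x \<inter> low_words N = {}}"
    then show "x + y \<in> {x. keys x \<inter> low_words N = {}}"
      using keys_add[of x y] by blast
  qed (auto simp: in_keys_iff disjoint_iff)
  moreover have "keys (a * g * b) \<inter> low_words N = {}"
    if "g \<in> S2 N R \<union> {letter j | j. j \<notin> N}" for a g b
  proof -
    have "set (letters w) \<subseteq> N \<longrightarrow> length (letters w) \<ge> 2" if "w \<in> keys g" for w
      using \<open>g \<in> _\<close> that keys_S2[of g N R w] by (auto simp: letter_def)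
    then have long: "w \<notin> low_words N" if "w \<in> keys g" for w
      using that by (fastforce simp: low_words_def)
    have "w \<notin> low_words N" if w: "w \<in> keys (a * g * b)" for w
    proof -
      obtain u v where "w = u + v" "u \<in> keys (a * g)"
        using keys_mult[of "a * g" b] w by blast
      moreover from this obtain u1 u2 where "u = u1 + u2" "u2 \<in> keys g"
        using keys_mult[of a g] by blast
      ultimately show ?thesis
        using long[of u2] by (auto simp: low_words_def plus_fword_def)
    qed
    then show ?thesis by blast
  qed
  ultimately have "exterior_ideal N R \<subseteq> {x. keys x \<inter> low_words N = {}}"
    unfolding exterior_ideal_def ideal_generated_def
    by (intro cvec.span_minimal) blast+
  then show ?thesis using assms by blast
qed

lemma low_tensor_eq_if_cong:
  assumes "y \<in> tensor_power N k" "z \<in> tensor_power N k" "k \<le> 1" "y - z \<in> exterior_ideal N R"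
  shows "y = z"
proof (rule poly_mapping_eqI)
  fix w show "lookup y w = lookup z w"
  proof (cases "w \<in> low_words N")
    case True
    then show ?thesis
      using exterior_ideal_low_words[OF assms(4)] by (auto simp: disjoint_iff in_keys_iff lookup_minus)
  next
    case False
    then have "w \<notin> keys x" if "x \<in> tensor_power N k" for x
      using that assms(3) by (auto simp: low_words_def tensor_power_def)
    then show ?thesis
      using assms(1,2) by (metis in_keys_iff)
  qed
qed

lemma diff_exterior_ideal:
  "x \<in> exterior_ideal N R \<Longrightarrow> y \<in> exterior_ideal N R \<Longrightarrow> x - y \<in> exterior_ideal N R"
  by (simp add: exterior_ideal_def ideal_generated_def cvec.span_diff)

text \<open>
  In these degrees there is no antisymmetry condition, so \<open>\<Lambda>_sub N R k\<close> is the full tensor power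
  and the representative chosen by \<open>pi_inv\<close> is unique.
\<close>

lemma pi_inv_low_degree:
  assumes "y \<in> tensor_power N k" "k \<le> 1" "x - y \<in> exterior_ideal N R"
  shows "pi_inv N R k x = y"
  unfolding pi_inv_def
proof (rule the_equality)
  show "y \<in> \<Lambda>_sub N R k \<and> x - y \<in> exterior_ideal N R"
    using assms by (auto simp: \<Lambda>_sub_def)
  fix z assume z: "z \<in> \<Lambda>_sub N R k \<and> x - z \<in> exterior_ideal N R"
  then have "(x - y) - (x - z) \<in> exterior_ideal N R"
    using assms(3) by (metis diff_exterior_ideal)
  then have "z - y \<in> exterior_ideal N R" by simp
  then show "z = y"
    using low_tensor_eq_if_cong[of z N k y] z assms by (auto simp: \<Lambda>_sub_def)
qed

lemma zero_in_exterior_ideal: "0 \<in> exterior_ideal N R"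
  by (simp add: exterior_ideal_def ideal_generated_def cvec.span_zero)

lemma one_not_in_exterior_ideal: "1 \<notin> exterior_ideal N R"
proof
  assume "1 \<in> exterior_ideal N R"
  from exterior_ideal_low_words[OF this] show False
    by (auto simp: low_words_def zero_fword_def)
qed

lemma tensor_power_zero_iff: "x \<in> tensor_power N 0 \<longleftrightarrow> (\<exists>c. x = c *\<^sub>C 1)"
proof
  assume x: "x \<in> tensor_power N 0"
  have "x = lookup x 0 *\<^sub>C 1"
  proof (rule poly_mapping_eqI)
    fix w :: "nat fword"
    show "lookup x w = lookup (lookup x 0 *\<^sub>C 1) w"
    proof (cases "w = 0")
      case False
      then have "letters w \<noteq> []" by (cases w) (simp add: zero_fword_def)
      then have "w \<notin> keys x" using x by (auto simp: tensor_power_def)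
      with False show ?thesis by (simp add: in_keys_iff lookup_one when_def)
    qed (simp add: lookup_one)
  qed
  then show "\<exists>c. x = c *\<^sub>C 1" by blast
qed (auto simp: tensor_power_def in_keys_iff lookup_one when_def zero_fword_def split: if_splits)

context
  fixes J :: "talg set" and ip :: "talg \<Rightarrow> talg \<Rightarrow> complex"
  assumes ip: "hermitian_inner_product J ip"
begin

lemma ip_add: "ip x (y + z) = ip x y + ip x z" and ip_cscale: "ip x (c *\<^sub>C y) = c * ip x y"
  and ip_cnj: "ip y x = cnj (ip x y)" and ip_null: "y \<in> J \<Longrightarrow> ip x y = 0"
  and ip_pos: "x \<notin> J \<Longrightarrow> 0 < Re (ip x x)"
  using ip unfolding hermitian_inner_product_def by blast+

definition vacuum_state :: "nat fword endo \<Rightarrow> complex"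
  where "vacuum_state s = ip 1 (app_endo s 1)"

lemma endo_functional_vacuum_state: "endo_functional vacuum_state"
  by (simp add: endo_functional_def vacuum_state_def app_endo_simps ip_add ip_cscale)

lemma vacuum_state_Cl_null: "s \<in> Cl_null J \<Longrightarrow> vacuum_state s = 0"
  by (simp add: Cl_null_def vacuum_state_def ip_null)

text \<open>
  Moving the adjoint to the other argument of the inner product makes the contraction act on
  the vacuum \<open>1\<close>, which it annihilates.
\<close>

lemma vacuum_state_adjoint_left:
  assumes "adjoint_endo J ip \<gamma> \<gamma>'" "app_endo \<gamma> 1 \<in> J"
  shows "vacuum_state (\<gamma>' * s) = 0"
proof -
  have "ip 1 (app_endo \<gamma>' (app_endo s 1)) = cnj (ip (app_endo \<gamma>' (app_endo s 1)) 1)"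
    by (rule ip_cnj)
  also have "\<dots> = cnj (ip (app_endo s 1) (app_endo \<gamma> 1))"
    using assms(1) by (simp add: adjoint_endo_def)
  also have "\<dots> = 0"
    using assms(2) by (simp add: ip_null)
  finally show ?thesis by (simp add: vacuum_state_def times_endo.rep_eq)
qed

lemma vacuum_state_contraction_right:
  assumes "s \<in> Cl J" "app_endo \<gamma> 1 \<in> J"
  shows "vacuum_state (s * \<gamma>) = 0"
  using assms by (simp add: vacuum_state_def times_endo.rep_eq Cl_def ip_null)

text \<open>
  The value is the squared norm of \<open>\<gamma>' 1\<close>.  It vanishes only if the inner product of \<open>1\<close> with
  \<open>\<gamma> v\<close> does, for \<open>v\<close> the basis vector dual to the contracted one; but \<open>\<gamma> v\<close> is the scalar
  \<open>lam 1 / lam 0\<close>.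
\<close>

lemma vacuum_state_contraction_times_adjoint:
  assumes J: "J = exterior_ideal N Rp"
    and con: "contraction N Rm Rp lam (letter k) \<gamma>" and k: "k \<in> N"
    and lam: "\<And>k. lam k \<noteq> 0" and adj: "adjoint_endo J ip \<gamma> \<gamma>'"
  shows "vacuum_state (\<gamma> * \<gamma>') \<noteq> 0"
proof
  assume *: "vacuum_state (\<gamma> * \<gamma>') = 0"
  let ?v = "letter k :: talg"
  have v: "?v \<in> tensor_power N 1" and one: "1 \<in> tensor_power N 0"
    using k by (auto simp: tensor_power_def letter_def zero_fword_def)
  have "app_endo \<gamma> ?v \<in> \<Lambda>_quot N Rp 0"
    and pair: "pairing N Rm Rp lam 0 1 (app_endo \<gamma> ?v) = pairing N Rm Rp lam 1 ?v ?v"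
    using con v one unfolding contraction_def by (auto dest!: spec[of _ 0] bspec[of _ _ ?v] bspec[of _ _ 1])
  then obtain c where c: "app_endo \<gamma> ?v - c *\<^sub>C 1 \<in> J"
    by (auto simp: \<Lambda>_quot_def tensor_power_zero_iff J)
  have self: "pi_inv N R j x = x" if "x \<in> tensor_power N j" "j \<le> 1" for x j R
    using that by (intro pi_inv_low_degree) (auto simp: zero_in_exterior_ideal)
  have "pi_inv N Rp 0 (app_endo \<gamma> ?v) = c *\<^sub>C 1"
    using c by (intro pi_inv_low_degree) (auto simp: tensor_power_zero_iff J)
  then have "lam 0 * pairing_T 1 (c *\<^sub>C 1) = lam 1 * pairing_T ?v ?v"
    using pair self[OF v] self[OF one] by (simp add: pairing_def)
  moreover have "pairing_T ?v ?v = 1"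
    by (simp add: pairing_T_def letter_def)
  ultimately have "c \<noteq> 0"
    using lam[of 1] by (auto simp: pairing_T_def)
  have "ip 1 (app_endo \<gamma> ?v) = ip 1 (c *\<^sub>C 1) + ip 1 (app_endo \<gamma> ?v - c *\<^sub>C 1)"
    by (simp flip: ip_add)
  also have "\<dots> = c * ip 1 1"
    using c by (simp add: ip_cscale ip_null)
  also have "\<dots> \<noteq> 0"
  proof -
    have "0 < Re (ip 1 1)"
      using one_not_in_exterior_ideal[of N Rp] by (simp add: ip_pos J)
    then show ?thesis using \<open>c \<noteq> 0\<close> by auto
  qed
  finally have "ip (app_endo \<gamma>' 1) ?v \<noteq> 0"
    using adj by (simp add: adjoint_endo_def)
  moreover have "ip y x = 0" if "y \<in> J" for x y
    using ip_null[OF that, of x] ip_cnj[of y x] by simp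
  ultimately have "app_endo \<gamma>' 1 \<notin> J" by blast
  then have "0 < Re (ip (app_endo \<gamma>' 1) (app_endo \<gamma>' 1))"
    by (rule ip_pos)
  also have "ip (app_endo \<gamma>' 1) (app_endo \<gamma>' 1) = vacuum_state (\<gamma> * \<gamma>')"
    using adj by (simp add: adjoint_endo_def vacuum_state_def times_endo.rep_eq)
  finally show False using * by simp
qed

end

section \<open>A family of weight modules of quantized sl2\<close>

text \<open>
  \<open>weighted_shift s d\<close> is the operator \<open>m\<^sub>n \<mapsto> s(n) m\<^sub>n\<^sub>+\<^sub>d\<close> on the space with basis \<open>m\<^sub>n\<close>, \<open>n\<close> an
  integer.  Generators of quantized \<open>sl\<^sub>2\<close> act on weight modules by such operators.
\<close>

lift_definition weighted_shift_fun :: "(int \<Rightarrow> complex) \<Rightarrow> int \<Rightarrow> (int \<Rightarrow>\<^sub>0 complex) \<Rightarrow> (int \<Rightarrow>\<^sub>0 complex)"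
  is "\<lambda>s d f k. s (k - d) * f (k - d)"
proof -
  fix s :: "int \<Rightarrow> complex" and d and f :: "int \<Rightarrow> complex"
  assume "finite {k. f k \<noteq> 0}"
  then have "finite ((\<lambda>k. k + d) ` {k. f k \<noteq> 0})" by simp
  moreover have "{k. s (k - d) * f (k - d) \<noteq> 0} \<subseteq> (\<lambda>k. k + d) ` {k. f k \<noteq> 0}"
    by (force simp: image_iff intro: diff_add_cancel[symmetric])
  ultimately show "finite {k. s (k - d) * f (k - d) \<noteq> 0}"
    by (rule rev_finite_subset)
qed

lift_definition weighted_shift :: "(int \<Rightarrow> complex) \<Rightarrow> int \<Rightarrow> int endo" is weighted_shift_fun
  by (auto simp: linear_cscale_iff weighted_shift_fun.rep_eq lookup_add algebra_simps
      intro!: poly_mapping_eqI)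

lemma lookup_weighted_shift:
  "lookup (app_endo (weighted_shift s d) x) k = s (k - d) * lookup x (k - d)"
  by (simp add: weighted_shift.rep_eq weighted_shift_fun.rep_eq)

lemma weighted_shift_mult:
  "weighted_shift s d * weighted_shift s' d' = weighted_shift (\<lambda>n. s (n + d') * s' n) (d + d')"
  by (intro endo_eqI poly_mapping_eqI)
     (simp add: times_endo.rep_eq lookup_weighted_shift algebra_simps)

lemma weighted_shift_one: "1 = weighted_shift (\<lambda>n. 1) 0"
  by (intro endo_eqI poly_mapping_eqI) (simp add: one_endo.rep_eq lookup_weighted_shift)

lemma weighted_shift_scale: "scale_endo c (weighted_shift s d) = weighted_shift (\<lambda>n. c * s n) d"
  by (intro endo_eqI poly_mapping_eqI) (simp add: scale_endo.rep_eq lookup_weighted_shift)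

lemma weighted_shift_diff:
  "weighted_shift s d - weighted_shift s' d = weighted_shift (\<lambda>n. s n - s' n) d"
  by (intro endo_eqI poly_mapping_eqI)
     (simp add: minus_endo.rep_eq lookup_weighted_shift lookup_minus algebra_simps)

lemma weighted_shift_eq_iff: "weighted_shift s d = weighted_shift s' d \<longleftrightarrow> s = s'"
proof
  assume eq: "weighted_shift s d = weighted_shift s' d"
  have "s n = s' n" for n
    using arg_cong[OF eq, of "\<lambda>\<phi>. lookup (app_endo \<phi> (Poly_Mapping.single n 1)) (n + d)"]
    by (simp add: lookup_weighted_shift)
  then show "s = s'" by blast
qed simp

locale quantum_sl2 =
  fixes q :: real
  assumes q_pos: "0 < q" and q_less_one: "q < 1"
begin

interpretation A1: quantum_flag q "Suc 0" "\<lambda>i j. 2" R 0 for R .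

definition Q :: complex
  where "Q = of_real q"

definition weight :: "int \<Rightarrow> complex"
  where "weight n = Q powi (- 2 * n)"

text \<open>
  The Casimir element \<open>F E + (q K + q\<^sup>-\<^sup>1 K\<^sup>-\<^sup>1) / (q - q\<^sup>-\<^sup>1)\<^sup>2\<close> is to act by the scalar \<open>a\<close>.  As \<open>F\<close> is
  the shift, this dictates the coefficient of \<open>E m\<^sub>n\<close>.
\<close>

definition raising_coeff :: "complex \<Rightarrow> int \<Rightarrow> complex" where
  "raising_coeff a n = a - (Q * weight n + inverse Q * inverse (weight n)) / (Q - inverse Q)\<^sup>2"

text \<open>
  Since the weights are unbounded in both directions, no basis vector has to be killed by \<open>E\<close>, a
  condition that would tie the Casimir eigenvalue \<open>a\<close> to the weights.  So \<open>a\<close> varies freely while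
  \<open>F\<close> and \<open>K\<close> stay the same.
\<close>

fun dense_gen :: "complex \<Rightarrow> gen \<Rightarrow> int endo" where
  "dense_gen a (GE i) = (if i = 0 then weighted_shift (raising_coeff a) (- 1) else 0)"
| "dense_gen a (GF i) = (if i = 0 then weighted_shift (\<lambda>n. 1) 1 else 0)"
| "dense_gen a (GK i) = (if i = 0 then weighted_shift weight 0 else 0)"
| "dense_gen a (GKi i) = (if i = 0 then weighted_shift (\<lambda>n. inverse (weight n)) 0 else 0)"

abbreviation dense_rep :: "complex \<Rightarrow> galg \<Rightarrow> int endo"
  where "dense_rep a \<equiv> representation (dense_gen a)"

lemma Q_nonzero: "Q \<noteq> 0" and Q_square: "Q\<^sup>2 \<noteq> 1" and Q_diff: "Q - inverse Q \<noteq> 0"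
proof -
  show Q0: "Q \<noteq> 0" using q_pos by (simp add: Q_def)
  have "q\<^sup>2 < 1" using q_pos q_less_one by (simp add: power_less_one_iff)
  then have "of_real (q\<^sup>2) \<noteq> (1::complex)" by (metis of_real_eq_1_iff less_irrefl)
  then show sq: "Q\<^sup>2 \<noteq> 1" by (simp add: Q_def)
  then show "Q - inverse Q \<noteq> 0" using Q0 by (simp add: field_simps power2_eq_square)
qed

lemma weight_nonzero: "weight n \<noteq> 0"
  by (simp add: weight_def Q_nonzero)

lemma weight_step: "weight (n + 1) = inverse (Q\<^sup>2) * weight n" "weight (n - 1) = Q\<^sup>2 * weight n"
proof -
  have "weight (n + 1) = Q powi (- 2 * n + - 2)" by (simp add: weight_def algebra_simps)
  also have "\<dots> = Q powi (- 2 * n) * Q powi (- 2)" using Q_nonzero by (subst power_int_add) auto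
  finally show "weight (n + 1) = inverse (Q\<^sup>2) * weight n" by (simp add: weight_def power_int_minus)
  have "weight (n - 1) = Q powi (- 2 * n + 2)" by (simp add: weight_def algebra_simps)
  also have "\<dots> = Q powi (- 2 * n) * Q powi 2" using Q_nonzero by (subst power_int_add) auto
  finally show "weight (n - 1) = Q\<^sup>2 * weight n" by (simp add: weight_def)
qed

text \<open>The commutation relation of \<open>E\<close> and \<open>F\<close> on the modules.\<close>

lemma raising_coeff_step:
  "raising_coeff a (n + 1) - raising_coeff a n = 1 / (Q - inverse Q) * (weight n - inverse (weight n))"
proof -
  define x where "x = weight n"
  define P where "P = Q - inverse Q"
  have x: "x \<noteq> 0" by (simp add: x_def weight_nonzero)
  have P: "P \<noteq> 0" using Q_diff by (simp add: P_def)
  have up: "Q * weight (n + 1) = inverse Q * x" "inverse Q * inverse (weight (n + 1)) = Q * inverse x"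
    using Q_nonzero unfolding weight_step(1) x_def by (simp_all add: power2_eq_square)
  have "raising_coeff a (n + 1) - raising_coeff a n =
      (Q * x + inverse Q * inverse x - (inverse Q * x + Q * inverse x)) / P\<^sup>2"
    unfolding raising_coeff_def up P_def[symmetric] x_def[symmetric] by (simp add: diff_divide_distrib)
  also have "Q * x + inverse Q * inverse x - (inverse Q * x + Q * inverse x) = P * (x - inverse x)"
    by (simp add: P_def algebra_simps)
  also have "P * (x - inverse x) / P\<^sup>2 = 1 / P * (x - inverse x)"
    using P by (simp add: power2_eq_square)
  finally show ?thesis by (simp add: x_def P_def)
qed

lemma dense_rep_Uq_ideal:
  assumes "x \<in> A1.Uq_ideal"
  shows "dense_rep a x = 0"
proof (rule representation_ideal_generated[OF _ assms[unfolded A1.Uq_ideal_def]])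
  have zero: "weighted_shift s d - weighted_shift s' d = 0" if "\<And>n. s n = s' n" for s s' d
  proof -
    have "s = s'" using that by blast
    then show ?thesis by simp
  qed
  have qi: "A1.qi_power 0 2 = Q\<^sup>2" "A1.qi_power 0 (- 2) = inverse (Q\<^sup>2)"
    "A1.qi_power 0 1 = Q" "A1.qi_power 0 (- 1) = inverse Q"
    by (simp_all add: A1.qi_power_def A1.q_power_def half_norm_def Q_def power_int_minus)
  have ca: "cartan (\<lambda>i j. 2) 0 0 = 2" by (simp add: cartan_def)
  note rep = representation_diff representation_mult representation_cscale
  have inv1: "dense_rep a (eK 0 * eKi 0 - 1) = 0" and inv2: "dense_rep a (eKi 0 * eK 0 - 1) = 0"
    unfolding rep by (simp_all add: weighted_shift_mult weighted_shift_one weight_nonzero)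
  have "dense_rep a (eK 0 * eE 0 * eKi 0 - Q\<^sup>2 *\<^sub>C eE 0)
      = weighted_shift (\<lambda>n. weight (n - 1) * raising_coeff a n * inverse (weight n)) (- 1)
        - weighted_shift (\<lambda>n. Q\<^sup>2 * raising_coeff a n) (- 1)"
    by (simp add: rep weighted_shift_mult weighted_shift_scale)
  also have "\<dots> = 0"
    by (rule zero) (simp add: weight_step weight_nonzero)
  finally have KE: "dense_rep a (eK 0 * eE 0 * eKi 0 - Q\<^sup>2 *\<^sub>C eE 0) = 0" .
  have "dense_rep a (eK 0 * eF 0 * eKi 0 - inverse (Q\<^sup>2) *\<^sub>C eF 0)
      = weighted_shift (\<lambda>n. weight (n + 1) * inverse (weight n)) 1
        - weighted_shift (\<lambda>n. inverse (Q\<^sup>2)) 1"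
    by (simp add: rep weighted_shift_mult weighted_shift_scale)
  also have "\<dots> = 0"
    by (rule zero) (simp add: weight_step weight_nonzero)
  finally have KF: "dense_rep a (eK 0 * eF 0 * eKi 0 - inverse (Q\<^sup>2) *\<^sub>C eF 0) = 0" .
  have "dense_rep a (eE 0 * eF 0 - eF 0 * eE 0 - (1 / (Q - inverse Q)) *\<^sub>C (eK 0 - eKi 0))
      = weighted_shift (\<lambda>n. raising_coeff a (n + 1) - raising_coeff a n) 0
        - weighted_shift (\<lambda>n. 1 / (Q - inverse Q) * (weight n - inverse (weight n))) 0"
    by (simp add: rep weighted_shift_mult weighted_shift_scale weighted_shift_diff)
  also have "\<dots> = 0"
    by (rule zero) (rule raising_coeff_step)
  finally have EF: "dense_rep a (eE 0 * eF 0 - eF 0 * eE 0 - (1 / (Q - inverse Q)) *\<^sub>C (eK 0 - eKi 0)) = 0" .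
  fix g assume "g \<in> {eK i * eK j - eK j * eK i | i j. i < Suc 0 \<and> j < Suc 0}
     \<union> {eK i * eKi i - 1 | i. i < Suc 0}
     \<union> {eKi i * eK i - 1 | i. i < Suc 0}
     \<union> {eK i * eE j * eKi i - A1.qi_power i (cartan (\<lambda>i j. 2) i j) *\<^sub>C eE j | i j. i < Suc 0 \<and> j < Suc 0}
     \<union> {eK i * eF j * eKi i - A1.qi_power i (- cartan (\<lambda>i j. 2) i j) *\<^sub>C eF j | i j. i < Suc 0 \<and> j < Suc 0}
     \<union> {eE i * eF j - eF j * eE i
          - (if i = j then (1 / (A1.qi_power i 1 - A1.qi_power i (- 1))) *\<^sub>C (eK i - eKi i) else 0)
        | i j. i < Suc 0 \<and> j < Suc 0}
     \<union> {A1.serre i j (eE i) (eE j) | i j. i < Suc 0 \<and> j < Suc 0 \<and> i \<noteq> j}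
     \<union> {A1.serre i j (eF i) (eF j) | i j. i < Suc 0 \<and> j < Suc 0 \<and> i \<noteq> j}
     \<union> {letter a | a. \<exists>i\<ge>Suc 0. a \<in> {GE i, GF i, GK i, GKi i}}"
  then show "dense_rep a g = 0"
    by (elim UnE CollectE exE conjE) (auto simp: ca qi inv1 inv2 KE KF EF)
qed

text \<open>The Levi factor is generated by \<open>K\<close> and its inverse, which act independently of the parameter.\<close>

lemma dense_rep_Uq_levi:
  assumes "x \<in> A1.Uq_levi"
  shows "dense_rep a x = dense_rep b x"
proof -
  obtain y where y: "y \<in> A1.levi_free" "x - y \<in> A1.Uq_ideal"
    using assms by (auto simp: A1.Uq_levi_def)
  have "dense_rep c x = dense_rep c y" for c
    using dense_rep_Uq_ideal[OF y(2), of c] by (simp add: representation_diff)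
  moreover have "dense_rep a y = dense_rep b y"
  proof (rule representation_cong)
    fix w h assume "w \<in> keys y" "h \<in> set (letters w)"
    then have "h \<in> A1.levi_gens" using y(1) by (auto simp: A1.levi_free_def)
    then show "dense_gen a h = dense_gen b h" by (auto simp: A1.levi_gens_def)
  qed
  ultimately show ?thesis by metis
qed

lemma dense_rep_center:
  assumes "c \<in> A1.center"
  shows "dense_rep a c * dense_rep a x = dense_rep a x * dense_rep a c"
proof -
  have "dense_rep a (c * x - x * c) = 0"
    using assms by (intro dense_rep_Uq_ideal) (auto simp: A1.center_def)
  then show ?thesis by (simp add: representation_diff representation_mult)
qed

lemma dense_rep_EKF:
  "dense_rep a (eE 0 * eKi 0 * eF 0) = weighted_shift (\<lambda>n. raising_coeff a (n + 1) * inverse (weight (n + 1))) 0"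
  by (simp add: representation_mult weighted_shift_mult)

text \<open>
  Both sides of the alleged congruence are compared at the parameters \<open>0\<close> and \<open>1\<close>.  The element \<open>x\<close> is
  arbitrary with the same action as \<open>c E K\<^sup>-\<^sup>1 F\<close>, which allows for other ways of writing
  that product, and the congruence modulo the Levi factor enters only through its
  consequence that the difference acts independently of the parameter.
\<close>

lemma E_Kinv_F_not_central_mod_levi:
  assumes "c \<noteq> 0" and C: "\<And>i. i \<in> I \<Longrightarrow> C i \<in> A1.center"
    and x: "\<And>a. dense_rep a x = scale_endo c (dense_rep a (eE 0 * eKi 0 * eF 0))"
    and levi: "\<And>a b. dense_rep a (x - (\<Sum>i\<in>I. t i *\<^sub>C C i)) = dense_rep b (x - (\<Sum>i\<in>I. t i *\<^sub>C C i))"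
  shows False
proof -
  let ?Z = "\<Sum>i\<in>I. t i *\<^sub>C C i"
  let ?F = "weighted_shift (\<lambda>n. 1) 1"
  have F: "dense_rep a (eF 0) = ?F" for a by simp
  have commute: "dense_rep a ?Z * ?F = ?F * dense_rep a ?Z" for a
    unfolding F[of a, symmetric] representation_sum representation_cscale sum_distrib_left sum_distrib_right
    by (intro sum.cong refl)
       (simp only: scale_endo_mult_left scale_endo_mult_right dense_rep_center[OF C])
  have "dense_rep 1 x - dense_rep 0 x = dense_rep 1 ?Z - dense_rep 0 ?Z"
    using levi[of 1 0] by (simp add: representation_diff algebra_simps)
  (* Everything in E K^-1 F except the Casimir part cancels. *)
  moreover have "dense_rep 1 x - dense_rep 0 x = weighted_shift (\<lambda>n. c * inverse (weight (n + 1))) 0"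
    unfolding x dense_rep_EKF weighted_shift_scale weighted_shift_diff
    by (simp add: raising_coeff_def algebra_simps)
  (* The left-hand side is a multiple of K^-1, the right-hand side commutes with F. *)
  ultimately have "weighted_shift (\<lambda>n. c * inverse (weight (n + 1))) 0 * ?F
      = ?F * weighted_shift (\<lambda>n. c * inverse (weight (n + 1))) 0"
    using commute[of 0] commute[of 1] by (simp add: left_diff_distrib right_diff_distrib)
  then have "(\<lambda>n. c * inverse (weight (n + 1 + 1))) = (\<lambda>n. c * inverse (weight (n + 1)))"
    by (simp add: weighted_shift_mult weighted_shift_eq_iff)
  from fun_cong[OF this, of 0] \<open>c \<noteq> 0\<close> have "weight (0 + 1 + 1) = weight (0 + 1)"
    by simp
  then have "inverse (Q\<^sup>2) * weight (0 + 1) = weight (0 + 1)"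
    by (simp only: weight_step(1))
  then show False
    using weight_nonzero[of "0 + 1"] Q_square by simp
qed

end

section \<open>Dolbeault-Dirac operators on the quantum projective line\<close>

lemma weyl_sl2:
  assumes "set ws \<subseteq> {0}" "keys \<beta> \<subseteq> {0}"
  shows "weyl (Suc 0) (\<lambda>i j. 2) ws \<beta> = (if even (length ws) then \<beta> else - \<beta>)"
  using assms(1)
proof (induction ws)
  case (Cons i ws)
  have reflection: "reflection (Suc 0) (\<lambda>i j. 2) 0 \<gamma> = - \<gamma>" if "keys \<gamma> \<subseteq> {0}" for \<gamma>
  proof (rule poly_mapping_eqI)
    fix k show "lookup (reflection (Suc 0) (\<lambda>i j. 2) 0 \<gamma>) k = lookup (- \<gamma>) k"
      using that by (cases "k = 0")
        (auto simp: reflection_def cartan_def lookup_minus lookup_single when_def in_keys_iff subset_iff)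
  qed
  have "i = 0" and IH: "weyl (Suc 0) (\<lambda>i j. 2) ws \<beta> = (if even (length ws) then \<beta> else - \<beta>)"
    using Cons by auto
  have "weyl (Suc 0) (\<lambda>i j. 2) (i # ws) \<beta>
      = reflection (Suc 0) (\<lambda>i j. 2) 0 (weyl (Suc 0) (\<lambda>i j. 2) ws \<beta>)"
    by (simp add: weyl_def \<open>i = 0\<close>)
  also have "\<dots> = - (if even (length ws) then \<beta> else - \<beta>)"
    unfolding IH by (rule reflection) (use assms(2) in auto)
  finally show ?case by simp
qed (simp add: weyl_def)

text \<open>
  The Weyl group has two elements, told apart by the parity of the word; so the only
  reduced words are the empty one and the simple reflection.
\<close>

lemma longest_word_sl2:
  assumes "longest_word (Suc 0) (\<lambda>i j. 2) {..<Suc 0} ws"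
  shows "ws = [0]"
proof -
  have dom: "{..<Suc 0} = {0}" by auto
  have same: "same_weyl_element (Suc 0) (\<lambda>i j. 2) us vs" if "set us \<subseteq> {0}" "set vs \<subseteq> {0}"
    "even (length us) = even (length vs)" for us vs
    using that by (simp add: same_weyl_element_def dom weyl_sl2)
  have ws: "set ws \<subseteq> {0}"
    and reduced: "\<And>us. set us \<subseteq> {0} \<Longrightarrow> same_weyl_element (Suc 0) (\<lambda>i j. 2) us ws \<Longrightarrow> length ws \<le> length us"
    and longest: "\<And>us. reduced_word (Suc 0) (\<lambda>i j. 2) {0} us \<Longrightarrow> length us \<le> length ws"
    using assms unfolding longest_word_def reduced_word_def dom by blast+
  have "\<not> same_weyl_element (Suc 0) (\<lambda>i j. 2) [] [0]"
  proof
    assume "same_weyl_element (Suc 0) (\<lambda>i j. 2) [] [0]"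
    then have "weyl (Suc 0) (\<lambda>i j. 2) [] (simple_root 0) = weyl (Suc 0) (\<lambda>i j. 2) [0] (simple_root 0)"
      unfolding same_weyl_element_def by (simp add: simple_root_def)
    then have "simple_root 0 = - simple_root 0"
      by (subst (asm) (1 2) weyl_sl2) (auto simp: simple_root_def)
    from arg_cong[OF this, of "\<lambda>\<beta>. lookup \<beta> 0"] show False
      by (simp add: simple_root_def)
  qed
  then have "us \<noteq> []" if "same_weyl_element (Suc 0) (\<lambda>i j. 2) us [0]" for us
    using that by blast
  then have "reduced_word (Suc 0) (\<lambda>i j. 2) {0} [0]"
    by (auto simp: reduced_word_def Suc_le_eq)
  then have "1 \<le> length ws"
    using longest[of "[0]"] by simp
  moreover have "length ws \<le> 1"
  proof (cases "even (length ws)")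
    case True
    then show ?thesis using reduced[of "[]"] same[of "[]" ws] ws by simp
  next
    case False
    then show ?thesis using reduced[of "[0]"] same[of "[0]" ws] ws by simp
  qed
  ultimately have "length ws = Suc 0" by simp
  then obtain i where "ws = [i]" by (auto simp: length_Suc_conv)
  then show ?thesis using ws by simp
qed

lemma letter_mult: "letter a * letter b = Poly_Mapping.single (Word [a, b]) 1"
  by (simp add: letter_def mult_single plus_fword_def)

lemma antipode_inv_E: "antipode_inv (eE i) = - (eE i * eKi i)"
  by (simp add: antipode_inv_def alg_antihom_def lin_ext_def letter_def)

lemma star_antipode_inv_E: "star (antipode_inv (eE i)) = - (eKi i * (eK i * eF i))"
proof -
  have eq: "- (eE i * eKi i) = Poly_Mapping.single (Word [GE i, GKi i]) (- 1)"
    by (rule poly_mapping_eqI) (simp add: letter_mult lookup_single when_def)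
  have "star (- (eE i * eKi i)) = (- 1) *\<^sub>C (eKi i * (eK i * eF i))"
    unfolding eq by (simp add: star_def conj_antihom_def)
  then show ?thesis by (simp add: antipode_inv_E)
qed

context quantum_sl2
begin

interpretation A1: quantum_flag q "Suc 0" "\<lambda>i j. 2" R 0 for R .

text \<open>
  As the only admissible word is \<open>[0]\<close>, there is one radical root, with index \<open>0\<close> and
  root vector \<open>E\<close>, and the sums defining \<open>D\<close> have one term each.
\<close>

lemma dirac_form:
  assumes "A1.dolbeault_dirac R J D" and R: "simple_root 0 \<in> R"
  obtains N Rp Rm lam ip \<gamma> \<gamma>' where "J = exterior_ideal {0} Rp" "\<And>k. lam k \<noteq> 0"
    "hermitian_inner_product J ip" "contraction {0} Rm Rp lam (letter 0) \<gamma>"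
    "adjoint_endo J ip \<gamma> \<gamma>'"
    "D = (- (eE 0 * eKi 0)) \<otimes>\<^sub>C \<gamma> + (- (eKi 0 * (eK 0 * eF 0))) \<otimes>\<^sub>C \<gamma>'"
proof -
  from assms(1) obtain ws \<rho> Rp Rm lam ip \<gamma> \<gamma>' where ws: "A1.admissible_word ws"
    and J: "J = exterior_ideal (A1.indices R ws) Rp" and lam: "\<And>k. lam k \<noteq> 0"
    and ip: "A1.invariant_inner_product (A1.indices R ws) \<rho> J ip"
    and con: "\<And>k. k \<in> A1.indices R ws \<Longrightarrow>
      contraction (A1.indices R ws) Rm Rp lam (letter k) (\<gamma> k) \<and> adjoint_endo J ip (\<gamma> k) (\<gamma>' k)"
    and D: "D = (\<Sum>k\<in>A1.indices R ws. antipode_inv (A1.root_vector ws k) \<otimes>\<^sub>C \<gamma> k)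
       + (\<Sum>k\<in>A1.indices R ws. star (antipode_inv (A1.root_vector ws k)) \<otimes>\<^sub>C \<gamma>' k)"
    unfolding A1.dolbeault_dirac_def by blast
  have "ws = [0]"
    using ws longest_word_sl2 by (simp add: A1.admissible_word_def)
  then have N: "A1.indices R ws = {0}"
    using R by (auto simp: A1.indices_def A1.beta_def weyl_def A1.radical_roots_def nonneg_def
        simple_root_def lookup_single lookup_one when_def)
  have E: "A1.root_vector ws 0 = eE 0"
    by (simp add: A1.root_vector_def \<open>ws = [0]\<close>)
  show thesis
  proof (rule that[of Rp lam ip Rm "\<gamma> 0" "\<gamma>' 0"])
    show "D = (- (eE 0 * eKi 0)) \<otimes>\<^sub>C \<gamma> 0 + (- (eKi 0 * (eK 0 * eF 0))) \<otimes>\<^sub>C \<gamma>' 0"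
      using D by (simp add: N E antipode_inv_E star_antipode_inv_E[unfolded antipode_inv_E])
  qed (use J lam ip con[of 0] N in \<open>auto simp: A1.invariant_inner_product_def\<close>)
qed

text \<open>
  The vacuum state kills three of the four terms of \<open>D * D\<close> as well as the tensors whose second
  factor is null, so it leaves a congruence in the quantized enveloping algebra alone.
\<close>

lemma no_Parthasarathy_formula:
  assumes D: "A1.dolbeault_dirac R J D" and R: "simple_root 0 \<in> R"
    and C: "\<And>i. i < n \<Longrightarrow> C i \<in> A1.center"
    and equiv: "A1.levi_equiv J (D * D) (\<Sum>i<(n::nat). C i \<otimes>\<^sub>C T i)"
  shows False
proof -
  obtain Rp Rm lam ip \<gamma> \<gamma>' where J: "J = exterior_ideal {0} Rp" and lam: "\<And>k. lam k \<noteq> 0"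
    and ip: "hermitian_inner_product J ip" and con: "contraction {0} Rm Rp lam (letter 0) \<gamma>"
    and adj: "adjoint_endo J ip \<gamma> \<gamma>'"
    and D: "D = (- (eE 0 * eKi 0)) \<otimes>\<^sub>C \<gamma> + (- (eKi 0 * (eK 0 * eF 0))) \<otimes>\<^sub>C \<gamma>'"
    using dirac_form[OF D R] by metis
  let ?a = "- (eE 0 * eKi 0)" and ?b = "- (eKi 0 * (eK 0 * eF 0))"
  let ?\<phi> = "vacuum_state ip"
  note \<phi> = endo_functional_vacuum_state[OF ip]
  have \<gamma>: "\<gamma> \<in> Cl J" "app_endo \<gamma> 1 \<in> J"
    using con by (auto simp: contraction_def J)
  define c where "c = ?\<phi> (\<gamma> * \<gamma>')"
  have c: "c \<noteq> 0"
    unfolding c_def by (rule vacuum_state_contraction_times_adjoint[OF ip J con _ lam adj]) simp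
  have "D * D = (?a * ?a) \<otimes>\<^sub>C (\<gamma> * \<gamma>) + (?a * ?b) \<otimes>\<^sub>C (\<gamma> * \<gamma>')
      + (?b * ?a) \<otimes>\<^sub>C (\<gamma>' * \<gamma>) + (?b * ?b) \<otimes>\<^sub>C (\<gamma>' * \<gamma>')"
    unfolding D by (simp only: distrib_left distrib_right pure_tensor_mult add.assoc add.left_commute)
  then have slice_D: "slice ?\<phi> (D * D) = c *\<^sub>C (?a * ?b)"
    by (simp add: slice_add[OF \<phi>] slice_pure_tensor[OF \<phi>] c_def
        vacuum_state_adjoint_left[OF ip adj \<gamma>(2)] vacuum_state_contraction_right[OF ip \<gamma>])
  obtain m a s where s: "\<And>i. i < m \<Longrightarrow> (a i \<in> A1.Uq_levi \<and> s i \<in> Cl J) \<or> s i \<in> Cl_null J"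
    and diff: "D * D - (\<Sum>i<n. C i \<otimes>\<^sub>C T i) = (\<Sum>i<(m::nat). a i \<otimes>\<^sub>C s i)"
    using equiv unfolding A1.levi_equiv_def by blast
  have "slice ?\<phi> (D * D - (\<Sum>i<n. C i \<otimes>\<^sub>C T i)) = slice ?\<phi> (\<Sum>i<m. a i \<otimes>\<^sub>C s i)"
    unfolding diff ..
  then have slices: "c *\<^sub>C (?a * ?b) - (\<Sum>i<n. ?\<phi> (T i) *\<^sub>C C i) = (\<Sum>i<m. ?\<phi> (s i) *\<^sub>C a i)"
    by (simp add: slice_minus[OF \<phi>] slice_sum[OF \<phi>] slice_pure_tensor[OF \<phi>] slice_D)
  have levi: "dense_rep u (\<Sum>i<m. ?\<phi> (s i) *\<^sub>C a i) = dense_rep v (\<Sum>i<m. ?\<phi> (s i) *\<^sub>C a i)" for u v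
    unfolding representation_sum representation_cscale
  proof (rule sum.cong)
    fix i assume "i \<in> {..<m}"
    then consider "a i \<in> A1.Uq_levi" | "s i \<in> Cl_null J" using s by blast
    then show "scale_endo (?\<phi> (s i)) (dense_rep u (a i)) = scale_endo (?\<phi> (s i)) (dense_rep v (a i))"
    proof cases
      case 1
      then show ?thesis by (simp only: dense_rep_Uq_levi[of "a i" u v])
    next
      case 2
      then show ?thesis by (simp add: vacuum_state_Cl_null[OF ip])
    qed
  qed simp
  show False
  proof (rule E_Kinv_F_not_central_mod_levi[of c "{..<n}" C _ "\<lambda>i. ?\<phi> (T i)"])
    show "dense_rep u (c *\<^sub>C (?a * ?b)) = scale_endo c (dense_rep u (eE 0 * eKi 0 * eF 0))" for u
      by (simp add: representation_cscale representation_mult weighted_shift_mult weight_nonzero mult.assoc)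
    show "dense_rep u (c *\<^sub>C (?a * ?b) - (\<Sum>i<n. ?\<phi> (T i) *\<^sub>C C i))
        = dense_rep v (c *\<^sub>C (?a * ?b) - (\<Sum>i<n. ?\<phi> (T i) *\<^sub>C C i))" for u v
      unfolding slices by (rule levi)
  qed (use c C in auto)
qed

end

theorem theorem1:
  fixes q :: real
  assumes "0 < q" and "q < 1"
  shows "\<exists>g br h r \<alpha> gram t.
    cominuscule_pair g br h r \<alpha> gram t \<and>
    (\<forall>J D. quantum_flag.dolbeault_dirac q r gram (roots g br h r \<alpha>) t J D \<longrightarrow>
      \<not> (\<exists>(n::nat) C T.
            (\<forall>i<n. C i \<in> quantum_flag.center q r gram \<and> T i \<in> Cl J) \<and>
            quantum_flag.levi_equiv q r gram t J (D * D) (\<Sum>i<n. C i \<otimes>\<^sub>C T i)))"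
proof -
  interpret quantum_sl2 q
    using assms by unfold_locales
  have R: "simple_root 0 \<in> roots sl2 sl2_bracket sl2_cartan (Suc 0) sl2_root"
    by (auto simp: roots_sl2 simple_root_def)
  show ?thesis
    by (intro exI[of _ sl2] exI[of _ sl2_bracket] exI[of _ sl2_cartan] exI[of _ "Suc 0"]
        exI[of _ sl2_root] exI[of _ "\<lambda>i j. 2"] exI[of _ 0] conjI allI impI notI cominuscule_pair_sl2)
       (use no_Parthasarathy_formula[OF _ R] in blast)
qed

end
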